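(* Let $\mathcal{C}$ and $\mathcal{X}$ be categories with finite limits and finite colimits, and let $F:\mathcal{C}\to\mathcal{X}$ be a faithful essential localization, with right adjoint $G$, unit $\eta:1_{\mathcal{C}}\to GF$, left adjoint $H$ of $F$, and counit $\theta:HF\to 1_{\mathcal{C}}$ of the adjunction $H\dashv F$. Then: (a) If every monomorphism in $\mathcal{X}$ is split, then, for every object $C$ in $\mathcal{C}$, the morphism $\eta_C:C\to GF(C)$ is an injective envelope of $C$, and, in particular, $C$ is an injective object if and only if $\eta_C$ is an isomorphism. In this case the categories $\mathrm{Spec}(\mathcal{C})$ and $\mathcal{X}$ are canonically equivalent to the category of injective objects in $\mathcal{C}$. (b) If every epimorphism in $\mathcal{X}$ is split, then, for every object $C$ in $\mathcal{C}$, the morphism $\theta_C:HF(C)\to C$ is a projective cover of $C$, and, in particular, $C$ is a projective object if and only if $\theta_C$ is an isomorphism. In this case the categories $\mathrm{Spec}(\mathcal{C}^{\mathrm{op}})$ and $\mathcal{X}^{\mathrm{op}}$ are canonically equivalent to the dual (opposite) of the category of projective objects in $\mathcal{C}$.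
   Context: A localization of $\mathcal{C}$ is an adjunction $(F,G,\eta,\varepsilon):\mathcal{C}\to\mathcal{X}$ ($F$ left adjoint to $G$, unit $\eta:1_{\mathcal{C}}\to GF$, counit $\varepsilon:FG\to 1_{\mathcal{X}}$) in which $F:\mathcal{C}\to\mathcal{X}$ preserves finite limits and $G:\mathcal{X}\to\mathcal{C}$ is fully faithful; one refers to it simply as $F$. It is faithful if the functor $F$ is faithful, and essential if $F$ also has a left adjoint $H:\mathcal{X}\to\mathcal{C}$; the unit and counit of $H\dashv F$ are denoted $\zeta:1_{\mathcal{X}}\to FH$ and $\theta:HF\to 1_{\mathcal{C}}$. A monomorphism is split if it has a left inverse; an epimorphism is split if it has a right inverse. A monomorphism $m:S\to A$ in a category is an essential monomorphism if every morphism $f:A\to B$ for which $fm$ is a monomorphism is itself a monomorphism. It is a pullback stable essential monomorphism if, for every morphism $u:X\to A$, the pullback projection $S\times_A X\to X$ of $m$ along $u$ is an essential monomorphism. An object $I$ is injective if, for every monomorphism $f:A\to B$, the map $\hom(B,I)\to\hom(A,I)$ of composition with $f$ is surjective. An injective envelope of $C$ is an essential monomorphism $C\to I$ with $I$ injective. Projective objects and projective covers in $\mathcal{C}$ are the injective objects and injective envelopes in $\mathcal{C}^{\mathrm{op}}$. The categories of injective objects and of projective objects are full subcategories of $\mathcal{C}$. For a category $\mathcal{A}$ with pullbacks, the spectral category $\mathrm{Spec}(\mathcal{A})$ is the category of fractions $\mathcal{A}[\Sigma^{-1}]$, where $\Sigma$ is the class of all pullback stable essential monomorphisms of $\mathcal{A}$;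 it comes with the canonical functor $\mathcal{A}\to\mathrm{Spec}(\mathcal{A})$, universal among functors out of $\mathcal{A}$ sending all elements of $\Sigma$ to isomorphisms. "Canonically equivalent" in (a) refers to the functor $\bar F:\mathrm{Spec}(\mathcal{C})\to\mathcal{X}$ induced by $F$ through the canonical functor $\mathcal{C}\to\mathrm{Spec}(\mathcal{C})$, and to the functor from $\mathcal{X}$ to the category of injective objects of $\mathcal{C}$ given by $G$; in (b) it refers to the dual functors, with $H$ in place of $G$. *)

theory Defs
  imports Main
begin

section \<open>Categories, functors, natural transformations\<close>

record ('o, 'm) cat =
  Obj :: "'o set"
  Arr :: "'m set"
  Dom :: "'m \<Rightarrow> 'o"
  Cod :: "'m \<Rightarrow> 'o"
  Ident :: "'o \<Rightarrow> 'm"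
  Comp :: "'m \<Rightarrow> 'm \<Rightarrow> 'm"  (infixl "\<cdot>\<index>" 70)

definition hom :: "('o, 'm) cat \<Rightarrow> 'o \<Rightarrow> 'o \<Rightarrow> 'm set" where
  "hom C A B = {f \<in> Arr C. Dom C f = A \<and> Cod C f = B}"

locale category =
  fixes C :: "('o, 'm) cat" (structure)
  assumes Dom_in: "f \<in> Arr C \<Longrightarrow> Dom C f \<in> Obj C"
    and Cod_in: "f \<in> Arr C \<Longrightarrow> Cod C f \<in> Obj C"
    and Ident_hom: "A \<in> Obj C \<Longrightarrow> Ident C A \<in> hom C A A"
    and Comp_hom: "\<lbrakk>f \<in> hom C A B; g \<in> hom C B D\<rbrakk> \<Longrightarrow> g \<cdot> f \<in> hom C A D"
    and Comp_Ident: "f \<in> hom C A B \<Longrightarrow> f \<cdot> Ident C A = f"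
    and Ident_Comp: "f \<in> hom C A B \<Longrightarrow> Ident C B \<cdot> f = f"
    and Comp_assoc: "\<lbrakk>f \<in> hom C A B; g \<in> hom C B D; h \<in> hom C D E\<rbrakk>
      \<Longrightarrow> (h \<cdot> g) \<cdot> f = h \<cdot> (g \<cdot> f)"

definition opcat :: "('o, 'm) cat \<Rightarrow> ('o, 'm) cat" where
  "opcat C = \<lparr>Obj = Obj C, Arr = Arr C, Dom = Cod C, Cod = Dom C, Ident = Ident C,
     Comp = (\<lambda>g f. f \<cdot>\<^bsub>C\<^esub> g)\<rparr>"

definition full_subcat :: "('o, 'm) cat \<Rightarrow> ('o \<Rightarrow> bool) \<Rightarrow> ('o, 'm) cat" where
  "full_subcat C P = \<lparr>Obj = {A \<in> Obj C. P A}, Arr = {f \<in> Arr C. P (Dom C f) \<and> P (Cod C f)},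
     Dom = Dom C, Cod = Cod C, Ident = Ident C, Comp = Comp C\<rparr>"

text \<open>A functor is given by its two maps only, so the same pair of maps is also the opposite
  functor between the opposite categories, and a corestriction of the functor to a full
  subcategory of its codomain.\<close>

record ('o, 'm, 'p, 'n) fnct =
  fob :: "'o \<Rightarrow> 'p"
  far :: "'m \<Rightarrow> 'n"

definition is_functor :: "('o, 'm) cat \<Rightarrow> ('p, 'n) cat \<Rightarrow> ('o, 'm, 'p, 'n) fnct \<Rightarrow> bool" where
  "is_functor C D F \<longleftrightarrow> category C \<and> category D \<and>
     (\<forall>A\<in>Obj C. fob F A \<in> Obj D) \<and>
     (\<forall>A B. \<forall>f\<in>hom C A B. far F f \<in> hom D (fob F A) (fob F B)) \<and>
     (\<forall>A\<in>Obj C. far F (Ident C A) = Ident D (fob F A)) \<and>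
     (\<forall>A B E. \<forall>f\<in>hom C A B. \<forall>g\<in>hom C B E. far F (g \<cdot>\<^bsub>C\<^esub> f) = far F g \<cdot>\<^bsub>D\<^esub> far F f)"

definition id_fnct :: "('o, 'm, 'o, 'm) fnct" where
  "id_fnct = \<lparr>fob = (\<lambda>A. A), far = (\<lambda>f. f)\<rparr>"

definition comp_fnct ::
  "('p, 'n, 'q, 'k) fnct \<Rightarrow> ('o, 'm, 'p, 'n) fnct \<Rightarrow> ('o, 'm, 'q, 'k) fnct" where
  "comp_fnct G F = \<lparr>fob = (\<lambda>A. fob G (fob F A)), far = (\<lambda>f. far G (far F f))\<rparr>"

definition fnct_agree ::
  "('o, 'm) cat \<Rightarrow> ('o, 'm, 'p, 'n) fnct \<Rightarrow> ('o, 'm, 'p, 'n) fnct \<Rightarrow> bool" where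
  "fnct_agree C F G \<longleftrightarrow> (\<forall>A\<in>Obj C. fob F A = fob G A) \<and> (\<forall>f\<in>Arr C. far F f = far G f)"

definition faithful :: "('o, 'm) cat \<Rightarrow> ('o, 'm, 'p, 'n) fnct \<Rightarrow> bool" where
  "faithful C F \<longleftrightarrow> (\<forall>A\<in>Obj C. \<forall>B\<in>Obj C. inj_on (far F) (hom C A B))"

definition full :: "('o, 'm) cat \<Rightarrow> ('p, 'n) cat \<Rightarrow> ('o, 'm, 'p, 'n) fnct \<Rightarrow> bool" where
  "full C D F \<longleftrightarrow>
     (\<forall>A\<in>Obj C. \<forall>B\<in>Obj C. hom D (fob F A) (fob F B) \<subseteq> far F ` hom C A B)"

definition nat_trans :: "('o, 'm) cat \<Rightarrow> ('p, 'n) cat \<Rightarrow> ('o, 'm, 'p, 'n) fnct \<Rightarrow>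
    ('o, 'm, 'p, 'n) fnct \<Rightarrow> ('o \<Rightarrow> 'n) \<Rightarrow> bool" where
  "nat_trans C D F G t \<longleftrightarrow> is_functor C D F \<and> is_functor C D G \<and>
     (\<forall>A\<in>Obj C. t A \<in> hom D (fob F A) (fob G A)) \<and>
     (\<forall>A B. \<forall>f\<in>hom C A B. t B \<cdot>\<^bsub>D\<^esub> far F f = far G f \<cdot>\<^bsub>D\<^esub> t A)"

definition inverse_arrows :: "('o, 'm) cat \<Rightarrow> 'm \<Rightarrow> 'm \<Rightarrow> bool" where
  "inverse_arrows C f g \<longleftrightarrow> f \<in> Arr C \<and> g \<in> hom C (Cod C f) (Dom C f) \<and>
     g \<cdot>\<^bsub>C\<^esub> f = Ident C (Dom C f) \<and> f \<cdot>\<^bsub>C\<^esub> g = Ident C (Cod C f)"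

definition iso :: "('o, 'm) cat \<Rightarrow> 'm \<Rightarrow> bool" where
  "iso C f \<longleftrightarrow> (\<exists>g. inverse_arrows C f g)"

definition nat_iso :: "('o, 'm) cat \<Rightarrow> ('p, 'n) cat \<Rightarrow> ('o, 'm, 'p, 'n) fnct \<Rightarrow>
    ('o, 'm, 'p, 'n) fnct \<Rightarrow> ('o \<Rightarrow> 'n) \<Rightarrow> bool" where
  "nat_iso C D F G t \<longleftrightarrow> nat_trans C D F G t \<and> (\<forall>A\<in>Obj C. iso D (t A))"

definition equivalence_functor ::
  "('o, 'm) cat \<Rightarrow> ('p, 'n) cat \<Rightarrow> ('o, 'm, 'p, 'n) fnct \<Rightarrow> bool" where
  "equivalence_functor C D E \<longleftrightarrow> is_functor C D E \<and>
     (\<exists>K s t. is_functor D C K \<and> nat_iso C C (comp_fnct K E) id_fnct s \<and>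
        nat_iso D D (comp_fnct E K) id_fnct t)"


section \<open>Finite limits\<close>

definition is_cone :: "('i, 'j) cat \<Rightarrow> ('o, 'm) cat \<Rightarrow> ('i, 'j, 'o, 'm) fnct \<Rightarrow>
    'o \<Rightarrow> ('i \<Rightarrow> 'm) \<Rightarrow> bool" where
  "is_cone J C D L p \<longleftrightarrow> L \<in> Obj C \<and> (\<forall>i\<in>Obj J. p i \<in> hom C L (fob D i)) \<and>
     (\<forall>a\<in>Arr J. far D a \<cdot>\<^bsub>C\<^esub> p (Dom J a) = p (Cod J a))"

definition is_limit :: "('i, 'j) cat \<Rightarrow> ('o, 'm) cat \<Rightarrow> ('i, 'j, 'o, 'm) fnct \<Rightarrow>
    'o \<Rightarrow> ('i \<Rightarrow> 'm) \<Rightarrow> bool" where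
  "is_limit J C D L p \<longleftrightarrow> is_cone J C D L p \<and>
     (\<forall>M q. is_cone J C D M q \<longrightarrow> (\<exists>!u. u \<in> hom C M L \<and> (\<forall>i\<in>Obj J. p i \<cdot>\<^bsub>C\<^esub> u = q i)))"

text \<open>Every finite category is isomorphic to one whose objects and arrows are natural numbers, so
  letting the index categories range over such categories covers all finite diagrams.\<close>

definition finite_index_cat :: "(nat, nat) cat \<Rightarrow> bool" where
  "finite_index_cat J \<longleftrightarrow> category J \<and> finite (Obj J) \<and> finite (Arr J)"

definition has_finite_limits :: "('o, 'm) cat \<Rightarrow> bool" where
  "has_finite_limits C \<longleftrightarrow>
     (\<forall>J D. finite_index_cat J \<and> is_functor J C D \<longrightarrow> (\<exists>L p. is_limit J C D L p))"

definition has_finite_colimits :: "('o, 'm) cat \<Rightarrow> bool" where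
  "has_finite_colimits C \<longleftrightarrow> has_finite_limits (opcat C)"

definition preserves_finite_limits ::
  "('o, 'm) cat \<Rightarrow> ('p, 'n) cat \<Rightarrow> ('o, 'm, 'p, 'n) fnct \<Rightarrow> bool" where
  "preserves_finite_limits C X F \<longleftrightarrow>
     (\<forall>J D L p. finite_index_cat J \<and> is_functor J C D \<and> is_limit J C D L p \<longrightarrow>
        is_limit J X (comp_fnct F D) (fob F L) (\<lambda>i. far F (p i)))"

text \<open>The pullback of \<open>m : S \<rightarrow> A\<close> along \<open>u : X \<rightarrow> A\<close>; \<open>p\<close> is the projection to \<open>S\<close> and \<open>q\<close> the
  projection to \<open>X\<close>.\<close>

definition is_pullback :: "('o, 'm) cat \<Rightarrow> 'm \<Rightarrow> 'm \<Rightarrow> 'm \<Rightarrow> 'm \<Rightarrow> bool" where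
  "is_pullback C m u p q \<longleftrightarrow>
     m \<in> Arr C \<and> u \<in> Arr C \<and> Cod C m = Cod C u \<and>
     p \<in> hom C (Dom C q) (Dom C m) \<and> q \<in> hom C (Dom C q) (Dom C u) \<and>
     m \<cdot>\<^bsub>C\<^esub> p = u \<cdot>\<^bsub>C\<^esub> q \<and>
     (\<forall>Y. \<forall>a\<in>hom C Y (Dom C m). \<forall>b\<in>hom C Y (Dom C u). m \<cdot>\<^bsub>C\<^esub> a = u \<cdot>\<^bsub>C\<^esub> b \<longrightarrow>
        (\<exists>!h. h \<in> hom C Y (Dom C q) \<and> p \<cdot>\<^bsub>C\<^esub> h = a \<and> q \<cdot>\<^bsub>C\<^esub> h = b))"


section \<open>Adjunctions and localizations\<close>

definition adjunction :: "('o, 'm) cat \<Rightarrow> ('p, 'n) cat \<Rightarrow> ('o, 'm, 'p, 'n) fnct \<Rightarrow>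
    ('p, 'n, 'o, 'm) fnct \<Rightarrow> ('o \<Rightarrow> 'm) \<Rightarrow> ('p \<Rightarrow> 'n) \<Rightarrow> bool" where
  "adjunction C X F G \<eta> \<epsilon> \<longleftrightarrow> is_functor C X F \<and> is_functor X C G \<and>
     nat_trans C C id_fnct (comp_fnct G F) \<eta> \<and>
     nat_trans X X (comp_fnct F G) id_fnct \<epsilon> \<and>
     (\<forall>A\<in>Obj C. \<epsilon> (fob F A) \<cdot>\<^bsub>X\<^esub> far F (\<eta> A) = Ident X (fob F A)) \<and>
     (\<forall>Y\<in>Obj X. far G (\<epsilon> Y) \<cdot>\<^bsub>C\<^esub> \<eta> (fob G Y) = Ident C (fob G Y))"

definition localization :: "('o, 'm) cat \<Rightarrow> ('p, 'n) cat \<Rightarrow> ('o, 'm, 'p, 'n) fnct \<Rightarrow>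
    ('p, 'n, 'o, 'm) fnct \<Rightarrow> ('o \<Rightarrow> 'm) \<Rightarrow> ('p \<Rightarrow> 'n) \<Rightarrow> bool" where
  "localization C X F G \<eta> \<epsilon> \<longleftrightarrow> adjunction C X F G \<eta> \<epsilon> \<and> preserves_finite_limits C X F \<and>
     full X C G \<and> faithful X G"


section \<open>Essential monomorphisms, injective and projective objects\<close>

definition monic :: "('o, 'm) cat \<Rightarrow> 'm \<Rightarrow> bool" where
  "monic C m \<longleftrightarrow> m \<in> Arr C \<and>
     (\<forall>Y. \<forall>a\<in>hom C Y (Dom C m). \<forall>b\<in>hom C Y (Dom C m). m \<cdot>\<^bsub>C\<^esub> a = m \<cdot>\<^bsub>C\<^esub> b \<longrightarrow> a = b)"

definition epic :: "('o, 'm) cat \<Rightarrow> 'm \<Rightarrow> bool" where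
  "epic C e \<longleftrightarrow> e \<in> Arr C \<and>
     (\<forall>Y. \<forall>a\<in>hom C (Cod C e) Y. \<forall>b\<in>hom C (Cod C e) Y. a \<cdot>\<^bsub>C\<^esub> e = b \<cdot>\<^bsub>C\<^esub> e \<longrightarrow> a = b)"

definition split_monic :: "('o, 'm) cat \<Rightarrow> 'm \<Rightarrow> bool" where
  "split_monic C m \<longleftrightarrow> monic C m \<and>
     (\<exists>r\<in>hom C (Cod C m) (Dom C m). r \<cdot>\<^bsub>C\<^esub> m = Ident C (Dom C m))"

definition split_epic :: "('o, 'm) cat \<Rightarrow> 'm \<Rightarrow> bool" where
  "split_epic C e \<longleftrightarrow> epic C e \<and>
     (\<exists>r\<in>hom C (Cod C e) (Dom C e). e \<cdot>\<^bsub>C\<^esub> r = Ident C (Cod C e))"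

definition essential_monic :: "('o, 'm) cat \<Rightarrow> 'm \<Rightarrow> bool" where
  "essential_monic C m \<longleftrightarrow> monic C m \<and>
     (\<forall>B. \<forall>f\<in>hom C (Cod C m) B. monic C (f \<cdot>\<^bsub>C\<^esub> m) \<longrightarrow> monic C f)"

definition stable_essential_monic :: "('o, 'm) cat \<Rightarrow> 'm \<Rightarrow> bool" where
  "stable_essential_monic C m \<longleftrightarrow> essential_monic C m \<and>
     (\<forall>u p q. is_pullback C m u p q \<longrightarrow> essential_monic C q)"

definition injective :: "('o, 'm) cat \<Rightarrow> 'o \<Rightarrow> bool" where
  "injective C I \<longleftrightarrow> I \<in> Obj C \<and>
     (\<forall>A B. \<forall>f\<in>hom C A B. monic C f \<longrightarrow> (\<lambda>h. h \<cdot>\<^bsub>C\<^esub> f) ` hom C B I = hom C A I)"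

definition injective_envelope :: "('o, 'm) cat \<Rightarrow> 'o \<Rightarrow> 'm \<Rightarrow> bool" where
  "injective_envelope C A m \<longleftrightarrow> essential_monic C m \<and> Dom C m = A \<and> injective C (Cod C m)"

definition projective :: "('o, 'm) cat \<Rightarrow> 'o \<Rightarrow> bool" where
  "projective C = injective (opcat C)"

definition projective_cover :: "('o, 'm) cat \<Rightarrow> 'o \<Rightarrow> 'm \<Rightarrow> bool" where
  "projective_cover C = injective_envelope (opcat C)"

definition injectives :: "('o, 'm) cat \<Rightarrow> ('o, 'm) cat" where
  "injectives C = full_subcat C (injective C)"

definition projectives :: "('o, 'm) cat \<Rightarrow> ('o, 'm) cat" where
  "projectives C = full_subcat C (projective C)"


section \<open>Categories of fractions and the spectral category\<close>

text \<open>The category of fractions of \<open>C\<close> at \<open>S\<close> is built as usual: its arrows \<open>A \<rightarrow> B\<close> are finite paths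
  from \<open>A\<close> to \<open>B\<close> of arrows of \<open>C\<close> and formally reversed arrows of \<open>S\<close>, modulo the congruence
  generated by the identities and composites of \<open>C\<close> and by the requirement that reversal be
  inversion. Paths are written in the order in which they are travelled, so \<open>[Fwd f, Fwd g]\<close>
  stands for \<open>g \<circ> f\<close>.\<close>

datatype 'm step = Fwd 'm | Bwd 'm

fun path :: "('o, 'm) cat \<Rightarrow> 'm set \<Rightarrow> 'o \<Rightarrow> 'o \<Rightarrow> 'm step list \<Rightarrow> bool" where
  "path C S A B [] \<longleftrightarrow> A = B \<and> A \<in> Obj C"
| "path C S A B (Fwd f # p) \<longleftrightarrow> f \<in> Arr C \<and> Dom C f = A \<and> path C S (Cod C f) B p"
| "path C S A B (Bwd s # p) \<longleftrightarrow> s \<in> S \<and> s \<in> Arr C \<and> Cod C s = A \<and> path C S (Dom C s) B p"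

inductive path_eq ::
  "('o, 'm) cat \<Rightarrow> 'm set \<Rightarrow> 'o \<Rightarrow> 'o \<Rightarrow> 'm step list \<Rightarrow> 'm step list \<Rightarrow> bool"
  for C S where
  pe_refl: "path C S A B p \<Longrightarrow> path_eq C S A B p p"
| pe_sym: "path_eq C S A B p q \<Longrightarrow> path_eq C S A B q p"
| pe_trans: "path_eq C S A B p q \<Longrightarrow> path_eq C S A B q r \<Longrightarrow> path_eq C S A B p r"
| pe_append: "path_eq C S A B p q \<Longrightarrow> path_eq C S B D p' q' \<Longrightarrow> path_eq C S A D (p @ p') (q @ q')"
| pe_Ident: "A \<in> Obj C \<Longrightarrow> path_eq C S A A [Fwd (Ident C A)] []"
| pe_Comp: "f \<in> hom C A B \<Longrightarrow> g \<in> hom C B D \<Longrightarrow>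
    path_eq C S A D [Fwd f, Fwd g] [Fwd (g \<cdot>\<^bsub>C\<^esub> f)]"
| pe_Fwd_Bwd: "s \<in> S \<Longrightarrow> s \<in> hom C A B \<Longrightarrow> path_eq C S A A [Fwd s, Bwd s] []"
| pe_Bwd_Fwd: "s \<in> S \<Longrightarrow> s \<in> hom C A B \<Longrightarrow> path_eq C S B B [Bwd s, Fwd s] []"

definition path_class ::
  "('o, 'm) cat \<Rightarrow> 'm set \<Rightarrow> 'o \<Rightarrow> 'o \<Rightarrow> 'm step list \<Rightarrow> 'm step list set" where
  "path_class C S A B p = {q. path_eq C S A B p q}"

type_synonym ('o, 'm) frac = "'o \<times> 'o \<times> 'm step list set"

definition fractions :: "('o, 'm) cat \<Rightarrow> 'm set \<Rightarrow> ('o, ('o, 'm) frac) cat" where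
  "fractions C S = \<lparr>
     Obj = Obj C,
     Arr = {(A, B, path_class C S A B p) | A B p. path C S A B p},
     Dom = (\<lambda>(A, B, P). A),
     Cod = (\<lambda>(A, B, P). B),
     Ident = (\<lambda>A. (A, A, path_class C S A A [])),
     Comp = (\<lambda>(B, D, Q) (A, _, P). (A, D, \<Union>p\<in>P. \<Union>q\<in>Q. path_class C S A D (p @ q)))\<rparr>"

definition to_fractions ::
  "('o, 'm) cat \<Rightarrow> 'm set \<Rightarrow> ('o, 'm, 'o, ('o, 'm) frac) fnct" where
  "to_fractions C S = \<lparr>fob = (\<lambda>A. A),
     far = (\<lambda>f. (Dom C f, Cod C f, path_class C S (Dom C f) (Cod C f) [Fwd f]))\<rparr>"

definition Spec :: "('o, 'm) cat \<Rightarrow> ('o, ('o, 'm) frac) cat" where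
  "Spec C = fractions C {m. stable_essential_monic C m}"

definition to_Spec :: "('o, 'm) cat \<Rightarrow> ('o, 'm, 'o, ('o, 'm) frac) fnct" where
  "to_Spec C = to_fractions C {m. stable_essential_monic C m}"

text \<open>\<open>K\<close> is the functor \<open>Spec(C) \<rightarrow> X\<close> induced by \<open>F : C \<rightarrow> X\<close>; by \<open>fractions_universal\<close> below it exists
  and is unique as soon as \<open>F\<close> inverts the pullback stable essential monomorphisms.\<close>

definition Spec_induced :: "('o, 'm) cat \<Rightarrow> ('p, 'n) cat \<Rightarrow> ('o, 'm, 'p, 'n) fnct \<Rightarrow>
    ('o, ('o, 'm) frac, 'p, 'n) fnct \<Rightarrow> bool" where
  "Spec_induced C X F K \<longleftrightarrow>
     is_functor (Spec C) X K \<and> fnct_agree C (comp_fnct K (to_Spec C)) F"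


subsection \<open>The universal property\<close>

lemma homI: "f \<in> Arr C \<Longrightarrow> f \<in> hom C (Dom C f) (Cod C f)"
  by (simp add: hom_def)

lemma path_append:
  "path C S A B p \<Longrightarrow> path C S B D q \<Longrightarrow> path C S A D (p @ q)"
  by (induction C S A B p rule: path.induct) auto

lemma path_objs:
  assumes "category C" "path C S A B p" shows "A \<in> Obj C" "B \<in> Obj C"
proof -
  have "A \<in> Obj C \<and> B \<in> Obj C"
    using assms(2,1) by (induction C S A B p rule: path.induct)
      (auto simp: category.Dom_in category.Cod_in)
  then show "A \<in> Obj C" "B \<in> Obj C" by auto
qed

lemma path_eq_path:
  assumes "category C" "path_eq C S A B p q" shows "path C S A B p" "path C S A B q"
proof -
  have "path C S A B p \<and> path C S A B q"
    using assms(2)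
  proof (induction rule: path_eq.induct)
    case (pe_Ident A)
    then show ?case using category.Ident_hom[OF assms(1)] by (auto simp: hom_def)
  next
    case (pe_Comp f A B g D)
    then show ?case using category.Comp_hom[OF assms(1) pe_Comp] category.Cod_in[OF assms(1)]
      by (auto simp: hom_def)
  qed (use assms(1) in \<open>auto simp: hom_def category.Dom_in category.Cod_in intro: path_append\<close>)
  then show "path C S A B p" "path C S A B q" by auto
qed

lemma path_class_eq:
  "path_eq C S A B p q \<Longrightarrow> path_class C S A B p = path_class C S A B q"
  unfolding path_class_def by (auto intro: pe_sym pe_trans)

lemma path_class_self: "path C S A B p \<Longrightarrow> p \<in> path_class C S A B p"
  unfolding path_class_def by (auto intro: pe_refl)

lemma fractions_Comp:
  assumes "path C S A B p" "path C S B D q"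
  shows "Comp (fractions C S) (B, D, path_class C S B D q) (A, B, path_class C S A B p)
    = (A, D, path_class C S A D (p @ q))"
proof -
  have *: "path_class C S A D (p' @ q') = path_class C S A D (p @ q)"
    if "p' \<in> path_class C S A B p" "q' \<in> path_class C S B D q" for p' q'
  proof -
    have "path_eq C S A B p p'" "path_eq C S B D q q'" using that by (auto simp: path_class_def)
    from path_class_eq[OF pe_append[OF this]] show ?thesis by simp
  qed
  have "(\<Union>p'\<in>path_class C S A B p. \<Union>q'\<in>path_class C S B D q. path_class C S A D (p' @ q'))
      = path_class C S A D (p @ q)"
    using path_class_self[OF assms(1)] path_class_self[OF assms(2)] * by blast
  then show ?thesis by (simp add: fractions_def)
qed

lemma fractions_hom:
  "x \<in> hom (fractions C S) A B \<longleftrightarrow> (\<exists>p. path C S A B p \<and> x = (A, B, path_class C S A B p))"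
  unfolding hom_def fractions_def by auto

lemma fractions_sel:
  "Obj (fractions C S) = Obj C"
  "Ident (fractions C S) A = (A, A, path_class C S A A [])"
  by (simp_all add: fractions_def)

lemma fractions_category:
  assumes "category C" shows "category (fractions C S)"
proof
  fix f assume "f \<in> Arr (fractions C S)"
  then show "Dom (fractions C S) f \<in> Obj (fractions C S)"
    and "Cod (fractions C S) f \<in> Obj (fractions C S)"
    using path_objs[OF assms] by (auto simp: fractions_def)
next
  fix A assume "A \<in> Obj (fractions C S)"
  then show "Ident (fractions C S) A \<in> hom (fractions C S) A A"
    unfolding fractions_hom fractions_sel by (intro exI[of _ "[]"]) simp
next
  fix A B D f g
  assume "f \<in> hom (fractions C S) A B" "g \<in> hom (fractions C S) B D"
  then show "Comp (fractions C S) g f \<in> hom (fractions C S) A D"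
    unfolding fractions_hom by (auto simp: fractions_Comp intro: path_append)
next
  fix A B f assume "f \<in> hom (fractions C S) A B"
  then obtain p where p: "path C S A B p" "f = (A, B, path_class C S A B p)"
    unfolding fractions_hom by auto
  have "path C S A A []" "path C S B B []" using path_objs[OF assms p(1)] by auto
  then show "Comp (fractions C S) f (Ident (fractions C S) A) = f"
    and "Comp (fractions C S) (Ident (fractions C S) B) f = f"
    using p by (simp_all add: fractions_sel fractions_Comp del: path.simps)
next
  fix A B D E f g h
  assume "f \<in> hom (fractions C S) A B" "g \<in> hom (fractions C S) B D"
    "h \<in> hom (fractions C S) D E"
  then show "Comp (fractions C S) (Comp (fractions C S) h g) f =
      Comp (fractions C S) h (Comp (fractions C S) g f)"
    unfolding fractions_hom by (auto simp: fractions_Comp path_append)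
qed

lemma Fwd_path:
  assumes "category C" "f \<in> hom C A B" shows "path C S A B [Fwd f]"
  using assms(2) category.Cod_in[OF assms(1)] by (auto simp: hom_def)

lemma Bwd_path:
  assumes "category C" "s \<in> S" "s \<in> hom C A B" shows "path C S B A [Bwd s]"
  using assms(2,3) category.Dom_in[OF assms(1)] by (auto simp: hom_def)

lemma to_fractions_far:
  "f \<in> hom C A B \<Longrightarrow> far (to_fractions C S) f = (A, B, path_class C S A B [Fwd f])"
  by (auto simp: hom_def to_fractions_def)

lemma to_fractions_functor:
  assumes "category C" shows "is_functor C (fractions C S) (to_fractions C S)"
proof -
  have "far (to_fractions C S) f \<in> hom (fractions C S) A B" if "f \<in> hom C A B" for f A B
    unfolding to_fractions_far[OF that] fractions_hom using Fwd_path[OF assms that] by blast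
  moreover have "far (to_fractions C S) (Ident C A) = Ident (fractions C S) A"
    if "A \<in> Obj C" for A
    using path_class_eq[OF pe_Ident[OF that]]
    by (simp add: to_fractions_far[OF category.Ident_hom[OF assms that]] fractions_sel)
  moreover have "far (to_fractions C S) (g \<cdot>\<^bsub>C\<^esub> f) =
      Comp (fractions C S) (far (to_fractions C S) g) (far (to_fractions C S) f)"
    if f: "f \<in> hom C A B" and g: "g \<in> hom C B D" for f g A B D
    using path_class_eq[OF pe_Comp[OF f g, of S]] Fwd_path[OF assms f] Fwd_path[OF assms g]
    by (simp add: to_fractions_far[OF f] to_fractions_far[OF g] fractions_Comp del: path.simps
        add: to_fractions_far[OF category.Comp_hom[OF assms f g]])
  ultimately show ?thesis
    using assms fractions_category[OF assms, of S]
    unfolding is_functor_def fractions_sel(1) by (simp add: to_fractions_def)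
qed

lemma fractions_inverse:
  assumes "category C" "s \<in> S" "s \<in> hom C A B"
  shows "inverse_arrows (fractions C S) (far (to_fractions C S) s)
    (B, A, path_class C S B A [Bwd s])"
proof -
  note F = Fwd_path[OF assms(1,3), of S] and B = Bwd_path[OF assms]
  have "far (to_fractions C S) s \<in> hom (fractions C S) A B"
    unfolding to_fractions_far[OF assms(3)] fractions_hom using F by blast
  moreover have "(B, A, path_class C S B A [Bwd s]) \<in> hom (fractions C S) B A"
    unfolding fractions_hom using B by blast
  ultimately show ?thesis
    using fractions_Comp[OF F B] fractions_Comp[OF B F]
      path_class_eq[OF pe_Fwd_Bwd[OF assms(2,3)]] path_class_eq[OF pe_Bwd_Fwd[OF assms(2,3)]]
    by (simp add: inverse_arrows_def hom_def fractions_sel to_fractions_far[OF assms(3)])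
qed

theorem to_fractions_inverts:
  "category C \<Longrightarrow> s \<in> S \<Longrightarrow> s \<in> Arr C \<Longrightarrow> iso (fractions C S) (far (to_fractions C S) s)"
  unfolding iso_def by (rule exI) (rule fractions_inverse[OF _ _ homI])

lemma inverse_arrows_unique:
  assumes "category C" "inverse_arrows C f g" "inverse_arrows C f h" shows "g = h"
proof -
  have f: "f \<in> hom C (Dom C f) (Cod C f)"
    and g: "g \<in> hom C (Cod C f) (Dom C f)" and h: "h \<in> hom C (Cod C f) (Dom C f)"
    using assms by (auto simp: inverse_arrows_def hom_def)
  have gf: "g \<cdot>\<^bsub>C\<^esub> f = Ident C (Dom C f)" and fh: "f \<cdot>\<^bsub>C\<^esub> h = Ident C (Cod C f)"
    using assms(2,3) by (simp_all add: inverse_arrows_def)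
  have "g = g \<cdot>\<^bsub>C\<^esub> (f \<cdot>\<^bsub>C\<^esub> h)"
    unfolding fh by (rule category.Comp_Ident[OF assms(1) g, symmetric])
  also have "\<dots> = (g \<cdot>\<^bsub>C\<^esub> f) \<cdot>\<^bsub>C\<^esub> h"
    by (rule category.Comp_assoc[OF assms(1) h f g, symmetric])
  also have "\<dots> = h"
    unfolding gf by (rule category.Ident_Comp[OF assms(1) h])
  finally show ?thesis .
qed

lemma functor_inverse_arrows:
  assumes F: "is_functor C X F" and fg: "inverse_arrows C f g"
  shows "inverse_arrows X (far F f) (far F g)"
proof -
  have f: "f \<in> hom C (Dom C f) (Cod C f)" and g: "g \<in> hom C (Cod C f) (Dom C f)"
    using fg by (auto simp: inverse_arrows_def hom_def)
  have "category C" "f \<in> Arr C" using F fg by (auto simp: is_functor_def inverse_arrows_def)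
  then have "Dom C f \<in> Obj C" "Cod C f \<in> Obj C"
    by (auto simp: category.Dom_in category.Cod_in)
  then have "far F (Ident C (Dom C f)) = Ident X (fob F (Dom C f))"
    "far F (Ident C (Cod C f)) = Ident X (fob F (Cod C f))"
    using F unfolding is_functor_def by blast+
  moreover have "far F f \<in> hom X (fob F (Dom C f)) (fob F (Cod C f))"
    "far F g \<in> hom X (fob F (Cod C f)) (fob F (Dom C f))"
    using F f g unfolding is_functor_def by blast+
  moreover have "far F (g \<cdot>\<^bsub>C\<^esub> f) = far F g \<cdot>\<^bsub>X\<^esub> far F f" "far F (f \<cdot>\<^bsub>C\<^esub> g) = far F f \<cdot>\<^bsub>X\<^esub> far F g"
    using F f g unfolding is_functor_def by blast+
  ultimately show ?thesis
    using fg by (auto simp: inverse_arrows_def hom_def)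
qed

definition inv_arrow :: "('o, 'm) cat \<Rightarrow> 'm \<Rightarrow> 'm" where
  "inv_arrow C f = (SOME g. inverse_arrows C f g)"

fun path_eval ::
  "('o, 'm) cat \<Rightarrow> ('p, 'n) cat \<Rightarrow> ('o, 'm, 'p, 'n) fnct \<Rightarrow> 'o \<Rightarrow> 'm step list \<Rightarrow> 'n" where
  "path_eval C X F A [] = Ident X (fob F A)"
| "path_eval C X F A (Fwd f # p) = path_eval C X F (Cod C f) p \<cdot>\<^bsub>X\<^esub> far F f"
| "path_eval C X F A (Bwd s # p) =
     path_eval C X F (Dom C s) p \<cdot>\<^bsub>X\<^esub> inv_arrow X (far F s)"

locale inverting_functor =
  fixes C :: "('o, 'm) cat" and X :: "('p, 'n) cat" and F :: "('o, 'm, 'p, 'n) fnct" and S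
  assumes F: "is_functor C X F" and inv: "\<And>s. s \<in> S \<Longrightarrow> s \<in> Arr C \<Longrightarrow> iso X (far F s)"
begin

lemma cats: "category C" "category X" using F by (auto simp: is_functor_def)
lemma F_ob: "A \<in> Obj C \<Longrightarrow> fob F A \<in> Obj X" using F by (auto simp: is_functor_def)
lemma F_hom: "f \<in> hom C A B \<Longrightarrow> far F f \<in> hom X (fob F A) (fob F B)"
  using F by (auto simp: is_functor_def)
lemma F_id: "A \<in> Obj C \<Longrightarrow> far F (Ident C A) = Ident X (fob F A)"
  using F by (auto simp: is_functor_def)
lemma F_comp: "f \<in> hom C A B \<Longrightarrow> g \<in> hom C B D \<Longrightarrow> far F (g \<cdot>\<^bsub>C\<^esub> f) = far F g \<cdot>\<^bsub>X\<^esub> far F f"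
  using F unfolding is_functor_def by blast

abbreviation "I s \<equiv> inv_arrow X (far F s)"
abbreviation "ev \<equiv> path_eval C X F"

lemma I: "s \<in> S \<Longrightarrow> s \<in> Arr C \<Longrightarrow> inverse_arrows X (far F s) (I s)"
  using inv[of s] unfolding iso_def inv_arrow_def by (rule someI_ex)

lemma I_hom: "s \<in> S \<Longrightarrow> s \<in> hom C A B \<Longrightarrow> I s \<in> hom X (fob F B) (fob F A)"
  using I[of s] F_hom[of s A B] by (auto simp: hom_def inverse_arrows_def)

lemma ev_hom: "path C S A B p \<Longrightarrow> ev A p \<in> hom X (fob F A) (fob F B)"
proof (induction p arbitrary: A)
  case Nil
  then show ?case using F_ob category.Ident_hom[OF cats(2)] by auto
next
  case (Cons z p)
  show ?case
  proof (cases z)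
    case (Fwd f)
    with Cons.prems have f: "f \<in> hom C A (Cod C f)" and p: "path C S (Cod C f) B p"
      by (auto simp: hom_def)
    show ?thesis
      using category.Comp_hom[OF cats(2) F_hom[OF f] Cons.IH[OF p]] by (simp add: Fwd)
  next
    case (Bwd s)
    with Cons.prems have s: "s \<in> S" "s \<in> hom C (Dom C s) A" and p: "path C S (Dom C s) B p"
      by (auto simp: hom_def)
    show ?thesis
      using category.Comp_hom[OF cats(2) I_hom[OF s] Cons.IH[OF p]] by (simp add: Bwd)
  qed
qed

lemma ev_append:
  "path C S A B p \<Longrightarrow> path C S B D q \<Longrightarrow> ev A (p @ q) = ev B q \<cdot>\<^bsub>X\<^esub> ev A p"
proof (induction p arbitrary: A)
  case Nil
  then show ?case using category.Comp_Ident[OF cats(2) ev_hom[of A D q]] by simp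
next
  case (Cons z p)
  note q = ev_hom[OF Cons.prems(2)]
  show ?case
  proof (cases z)
    case (Fwd f)
    with Cons.prems have f: "f \<in> hom C A (Cod C f)" and p: "path C S (Cod C f) B p"
      by (auto simp: hom_def)
    show ?thesis
      using category.Comp_assoc[OF cats(2) F_hom[OF f] ev_hom[OF p] q]
        Cons.IH[OF p Cons.prems(2)] by (simp add: Fwd)
  next
    case (Bwd s)
    with Cons.prems have s: "s \<in> S" "s \<in> hom C (Dom C s) A" and p: "path C S (Dom C s) B p"
      by (auto simp: hom_def)
    show ?thesis
      using category.Comp_assoc[OF cats(2) I_hom[OF s] ev_hom[OF p] q]
        Cons.IH[OF p Cons.prems(2)] by (simp add: Bwd)
  qed
qed

lemma ev_Fwd: "f \<in> hom C A B \<Longrightarrow> ev A [Fwd f] = far F f"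
  using category.Ident_Comp[OF cats(2) F_hom[of f A B]] by (auto simp: hom_def)

lemma ev_Bwd: "s \<in> S \<Longrightarrow> s \<in> hom C A B \<Longrightarrow> ev B [Bwd s] = I s"
  using category.Ident_Comp[OF cats(2) I_hom[of s A B]] by (auto simp: hom_def)

lemma ev_eq: "path_eq C S A B p q \<Longrightarrow> ev A p = ev A q"
proof (induction rule: path_eq.induct)
  case (pe_append A B p q D p' q')
  then show ?case
    using path_eq_path[OF cats(1) pe_append(1)] path_eq_path[OF cats(1) pe_append(2)]
    by (simp add: ev_append)
next
  case (pe_Ident A)
  then show ?case
    using ev_Fwd[OF category.Ident_hom[OF cats(1) pe_Ident]] F_id by simp
next
  case (pe_Comp f A B g D)
  then show ?case
    using ev_append[OF Fwd_path[OF cats(1) pe_Comp(1)] Fwd_path[OF cats(1) pe_Comp(2)]]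
      ev_Fwd[OF pe_Comp(1)] ev_Fwd[OF pe_Comp(2)] F_comp[OF pe_Comp]
      ev_Fwd[OF category.Comp_hom[OF cats(1) pe_Comp]]
    by (simp del: path_eval.simps)
next
  case (pe_Fwd_Bwd s A B)
  then have "s \<in> Arr C" by (simp add: hom_def)
  with pe_Fwd_Bwd show ?case
    using ev_append[OF Fwd_path[OF cats(1) pe_Fwd_Bwd(2)] Bwd_path[OF cats(1) pe_Fwd_Bwd]]
      ev_Fwd[OF pe_Fwd_Bwd(2)] ev_Bwd[OF pe_Fwd_Bwd] I[of s] F_hom[OF pe_Fwd_Bwd(2)]
    by (simp add: inverse_arrows_def hom_def del: path_eval.simps(2,3))
next
  case (pe_Bwd_Fwd s A B)
  then have "s \<in> Arr C" by (simp add: hom_def)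
  with pe_Bwd_Fwd show ?case
    using ev_append[OF Bwd_path[OF cats(1) pe_Bwd_Fwd] Fwd_path[OF cats(1) pe_Bwd_Fwd(2)]]
      ev_Fwd[OF pe_Bwd_Fwd(2)] ev_Bwd[OF pe_Bwd_Fwd] I[of s] F_hom[OF pe_Bwd_Fwd(2)]
    by (simp add: inverse_arrows_def hom_def del: path_eval.simps(2,3))
qed simp_all

definition ext :: "('o, ('o, 'm) frac, 'p, 'n) fnct" where
  "ext = \<lparr>fob = fob F, far = (\<lambda>(A, B, P). ev A (SOME p. p \<in> P))\<rparr>"

lemma ext_far:
  assumes "path C S A B p" shows "far ext (A, B, path_class C S A B p) = ev A p"
proof -
  have "(SOME q. q \<in> path_class C S A B p) \<in> path_class C S A B p"
    using path_class_self[OF assms] by (rule someI)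
  then have "path_eq C S A B p (SOME q. q \<in> path_class C S A B p)"
    unfolding path_class_def by (rule CollectD)
  from ev_eq[OF this] show ?thesis by (simp add: ext_def)
qed

lemma ext_functor: "is_functor (fractions C S) X ext"
  unfolding is_functor_def
proof (intro conjI ballI allI)
  show "category (fractions C S)" "category X" using cats fractions_category by auto
next
  fix A assume A: "A \<in> Obj (fractions C S)"
  then show "fob ext A \<in> Obj X" using F_ob by (simp add: ext_def fractions_sel)
  show "far ext (Ident (fractions C S) A) = Ident X (fob ext A)"
    using A ext_far[of A A "[]"] by (simp add: fractions_sel) (simp add: ext_def)
next
  fix A B f assume "f \<in> hom (fractions C S) A B"
  then show "far ext f \<in> hom X (fob ext A) (fob ext B)"
    unfolding fractions_hom using ev_hom ext_far by (auto simp: ext_def)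
next
  fix A B D f g assume "f \<in> hom (fractions C S) A B" "g \<in> hom (fractions C S) B D"
  then show "far ext (Comp (fractions C S) g f) = far ext g \<cdot>\<^bsub>X\<^esub> far ext f"
    unfolding fractions_hom by (auto simp: fractions_Comp ext_far path_append ev_append)
qed

lemma ext_agree: "fnct_agree C (comp_fnct ext (to_fractions C S)) F"
  unfolding fnct_agree_def
proof (intro conjI ballI)
  fix A show "fob (comp_fnct ext (to_fractions C S)) A = fob F A"
    by (simp add: comp_fnct_def ext_def to_fractions_def)
next
  fix f assume "f \<in> Arr C"
  then have f: "f \<in> hom C (Dom C f) (Cod C f)" by (rule homI)
  show "far (comp_fnct ext (to_fractions C S)) f = far F f"
    using ext_far[OF Fwd_path[OF cats(1) f]] ev_Fwd[OF f]
    by (simp add: comp_fnct_def to_fractions_far[OF f] del: path_eval.simps)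
qed

lemma ext_unique:
  assumes K: "is_functor (fractions C S) X K"
    and agree: "fnct_agree C (comp_fnct K (to_fractions C S)) F"
  shows "fnct_agree (fractions C S) K ext"
proof -
  have ob: "fob K A = fob F A" if "A \<in> Obj C" for A
    using agree that by (auto simp: fnct_agree_def comp_fnct_def to_fractions_def)
  have K_Fwd: "far K (A, B, path_class C S A B [Fwd f]) = far F f" if "f \<in> hom C A B" for f A B
  proof -
    have "f \<in> Arr C" using that by (simp add: hom_def)
    then have "far K (far (to_fractions C S) f) = far F f"
      using agree by (simp add: fnct_agree_def comp_fnct_def)
    then show ?thesis unfolding to_fractions_far[OF that] .
  qed
  have K_Bwd: "far K (B, A, path_class C S B A [Bwd s]) = I s"
    if "s \<in> S" "s \<in> hom C A B" for s A B
  proof -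
    have "inverse_arrows X (far F s) (far K (B, A, path_class C S B A [Bwd s]))"
      using functor_inverse_arrows[OF K fractions_inverse[OF cats(1) that]] K_Fwd[OF that(2)]
      by (simp add: to_fractions_far[OF that(2)])
    moreover have "inverse_arrows X (far F s) (I s)"
      using I that by (simp add: hom_def)
    ultimately show ?thesis by (rule inverse_arrows_unique[OF cats(2)])
  qed
  have step: "far K (A, B, path_class C S A B (z # p)) =
      far K (D, B, path_class C S D B p) \<cdot>\<^bsub>X\<^esub> far K (A, D, path_class C S A D [z])"
    if z: "path C S A D [z]" and p: "path C S D B p" for A B D z p
  proof -
    have "(A, D, path_class C S A D [z]) \<in> hom (fractions C S) A D"
      "(D, B, path_class C S D B p) \<in> hom (fractions C S) D B"
      using z p unfolding fractions_hom by blast+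
    then have "far K (Comp (fractions C S) (D, B, path_class C S D B p)
          (A, D, path_class C S A D [z])) =
        far K (D, B, path_class C S D B p) \<cdot>\<^bsub>X\<^esub> far K (A, D, path_class C S A D [z])"
      using K unfolding is_functor_def by blast
    then show ?thesis by (simp add: fractions_Comp[OF z p])
  qed
  have ev: "far K (A, B, path_class C S A B p) = ev A p" if "path C S A B p" for A B p
    using that
  proof (induction p arbitrary: A)
    case Nil
    then have A: "B = A" "A \<in> Obj C" by auto
    then have "far K (Ident (fractions C S) A) = Ident X (fob K A)"
      using K by (simp add: is_functor_def fractions_sel(1))
    with A show ?case by (simp add: fractions_sel ob)
  next
    case (Cons z p)
    show ?case
    proof (cases z)
      case (Fwd f)
      with Cons.prems have f: "f \<in> hom C A (Cod C f)" and p: "path C S (Cod C f) B p"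
        by (auto simp: hom_def)
      show ?thesis
        using step[OF Fwd_path[OF cats(1) f] p] Cons.IH[OF p] K_Fwd[OF f] by (simp add: Fwd)
    next
      case (Bwd s)
      with Cons.prems have s: "s \<in> S" "s \<in> hom C (Dom C s) A" and p: "path C S (Dom C s) B p"
        by (auto simp: hom_def)
      show ?thesis
        using step[OF Bwd_path[OF cats(1) s] p] Cons.IH[OF p] K_Bwd[OF s] by (simp add: Bwd)
    qed
  qed
  have "far K x = far ext x" if x: "x \<in> Arr (fractions C S)" for x
  proof -
    obtain A B p where "path C S A B p" "x = (A, B, path_class C S A B p)"
      using x by (auto simp: fractions_def)
    then show ?thesis by (simp add: ev ext_far)
  qed
  then show ?thesis using ob by (simp add: fnct_agree_def fractions_sel) (simp add: ext_def)
qed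

end

theorem fractions_universal:
  assumes "is_functor C X F" "\<And>s. s \<in> S \<Longrightarrow> s \<in> Arr C \<Longrightarrow> iso X (far F s)"
  shows "\<exists>K. is_functor (fractions C S) X K \<and> fnct_agree C (comp_fnct K (to_fractions C S)) F \<and>
    (\<forall>K'. is_functor (fractions C S) X K' \<and> fnct_agree C (comp_fnct K' (to_fractions C S)) F
       \<longrightarrow> fnct_agree (fractions C S) K' K)"
proof -
  interpret inverting_functor C X F S using assms by unfold_locales auto
  show ?thesis using ext_functor ext_agree ext_unique by blast
qed

end

theory Submission
  imports Defs
begin

text \<open>Since \<open>F\<close> has adjoints on both sides and is faithful, it preserves and
  reflects monomorphisms and inverts pullbacks of the arrows it inverts, so every arrow inverted
  by \<open>F\<close> is a pullback stable essential monomorphism; this applies to \<open>\<eta> A\<close>, because the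
  counit \<open>\<epsilon>\<close> is invertible. When monomorphisms of \<open>X\<close> split, \<open>F\<close> conversely inverts every
  essential monomorphism, hence \<open>Spec C\<close> is the category of fractions at the arrows inverted
  by \<open>F\<close>, and the induced functor to \<open>X\<close> has a quasi-inverse induced by \<open>G\<close>; objects \<open>G Y\<close> are injective by
  transposing along \<open>F -| G\<close>. The second part is the first one for the opposite categories,
  where \<open>H\<close> plays the role of \<open>G\<close>: in a triple \<open>H -| F -| G\<close>, the unit \<open>\<zeta>\<close> is invertible
  as soon as the counit \<open>\<epsilon>\<close> is.\<close>

section \<open>Categories and functors\<close>

context category
begin

lemma comp_simps [simp]:
  assumes "f \<in> Arr C" "g \<in> Arr C" "Dom C g = Cod C f"
  shows "g \<cdot> f \<in> Arr C" "Dom C (g \<cdot> f) = Dom C f" "Cod C (g \<cdot> f) = Cod C g"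
  using Comp_hom[of f "Dom C f" "Cod C f" g "Cod C g"] assms by (auto simp: hom_def)

lemma comp_assoc:
  "f \<in> Arr C \<Longrightarrow> g \<in> Arr C \<Longrightarrow> h \<in> Arr C \<Longrightarrow> Dom C g = Cod C f \<Longrightarrow> Dom C h = Cod C g
    \<Longrightarrow> (h \<cdot> g) \<cdot> f = h \<cdot> (g \<cdot> f)"
  by (rule Comp_assoc[of f "Dom C f" "Cod C f" g "Cod C g" h "Cod C h"]) (auto simp: hom_def)

lemma ident_simps [simp]:
  assumes "A \<in> Obj C"
  shows "Ident C A \<in> Arr C" "Dom C (Ident C A) = A" "Cod C (Ident C A) = A"
  using Ident_hom[OF assms] by (auto simp: hom_def)

lemma comp_ident [simp]: "f \<in> Arr C \<Longrightarrow> A = Dom C f \<Longrightarrow> f \<cdot> Ident C A = f"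
  using Comp_Ident homI by metis

lemma ident_comp [simp]: "f \<in> Arr C \<Longrightarrow> A = Cod C f \<Longrightarrow> Ident C A \<cdot> f = f"
  using Ident_Comp homI by metis

lemma dom_cod_in [simp]: "f \<in> Arr C \<Longrightarrow> Dom C f \<in> Obj C" "f \<in> Arr C \<Longrightarrow> Cod C f \<in> Obj C"
  by (simp_all add: Dom_in Cod_in)

lemma inverse_arrows_sym: "inverse_arrows C f g \<Longrightarrow> inverse_arrows C g f"
  by (auto simp: inverse_arrows_def hom_def)

lemma inverse_arrows_inv: "iso C f \<Longrightarrow> inverse_arrows C f (inv_arrow C f)"
  unfolding iso_def inv_arrow_def by (rule someI_ex)

section \<open>Monomorphisms, isomorphisms and pullbacks\<close>

lemma monicD:
  "monic C m \<Longrightarrow> a \<in> hom C Y (Dom C m) \<Longrightarrow> b \<in> hom C Y (Dom C m) \<Longrightarrow> m \<cdot> a = m \<cdot> b \<Longrightarrow> a = b"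
  unfolding monic_def by blast

text \<open>Cancelling the monic \<open>r\<close> in \<open>r \<cdot> (s \<cdot> r) = r\<close>
  leaves \<open>s \<cdot> r = Ident C (Dom C r)\<close>. Isomorphisms are later recognised this way,
  from a monic arrow with a one-sided inverse.\<close>

lemma monic_section_iso:
  assumes r: "monic C r" and s: "s \<in> hom C (Cod C r) (Dom C r)" "r \<cdot> s = Ident C (Cod C r)"
  shows "inverse_arrows C r s"
proof -
  have rA: "r \<in> Arr C" using r by (simp add: monic_def)
  have "r \<cdot> (s \<cdot> r) = r \<cdot> Ident C (Dom C r)"
    using rA s by (simp add: hom_def comp_assoc[symmetric])
  then have "s \<cdot> r = Ident C (Dom C r)"
    by (rule monicD[OF r, of _ "Dom C r", rotated 2])
      (use rA s in \<open>auto simp: hom_def\<close>)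
  then show ?thesis using rA s by (simp add: inverse_arrows_def)
qed

lemma monic_right_factor:
  assumes "f \<in> Arr C" "g \<in> Arr C" "Dom C g = Cod C f" "monic C (g \<cdot> f)"
  shows "monic C f"
  unfolding monic_def
proof (intro conjI allI ballI impI)
  fix Y a b assume ab: "a \<in> hom C Y (Dom C f)" "b \<in> hom C Y (Dom C f)" "f \<cdot> a = f \<cdot> b"
  then have "(g \<cdot> f) \<cdot> a = (g \<cdot> f) \<cdot> b" using assms by (simp add: hom_def comp_assoc)
  then show "a = b"
    by (rule monicD[OF assms(4), of _ Y, rotated 2]) (use ab assms in auto)
qed (rule assms)

lemma iso_monic: "iso C f \<Longrightarrow> monic C f"
proof -
  assume "iso C f"
  then obtain g where g: "inverse_arrows C f g" by (auto simp: iso_def)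
  show "monic C f"
    by (rule monic_right_factor[of f g])
      (use g in \<open>auto simp: inverse_arrows_def hom_def monic_def\<close>)
qed

lemma monic_comp:
  assumes "monic C f" "monic C g" "Dom C g = Cod C f" shows "monic C (g \<cdot> f)"
  unfolding monic_def
proof (intro conjI allI ballI impI)
  have arr: "f \<in> Arr C" "g \<in> Arr C" using assms by (auto simp: monic_def)
  then show "g \<cdot> f \<in> Arr C" using assms(3) by simp
  fix Y a b
  assume ab: "a \<in> hom C Y (Dom C (g \<cdot> f))" "b \<in> hom C Y (Dom C (g \<cdot> f))"
    "(g \<cdot> f) \<cdot> a = (g \<cdot> f) \<cdot> b"
  then have ab': "a \<in> hom C Y (Dom C f)" "b \<in> hom C Y (Dom C f)" using arr assms(3) by auto
  with ab(3) have "g \<cdot> (f \<cdot> a) = g \<cdot> (f \<cdot> b)" using arr assms(3) by (simp add: hom_def comp_assoc)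
  then have "f \<cdot> a = f \<cdot> b"
    by (rule monicD[OF assms(2), of _ Y, rotated 2])
      (use arr ab' assms(3) in \<open>auto simp: hom_def\<close>)
  then show "a = b" by (rule monicD[OF assms(1) ab'])
qed

text \<open>With \<open>n\<close> inverse to \<open>m\<close>, the arrow \<open>f\<close> is the
  composite of the monics \<open>f \<cdot> m\<close> and \<open>n\<close>.\<close>

lemma iso_comp_cancel_monic:
  assumes "f \<in> Arr C" "iso C m" "Dom C f = Cod C m" "monic C (f \<cdot> m)"
  shows "monic C f"
proof -
  obtain n where n: "inverse_arrows C m n" using assms(2) by (auto simp: iso_def)
  then have nm: "m \<in> Arr C" "n \<in> Arr C" "Dom C n = Cod C m" "Cod C n = Dom C m"
    by (auto simp: inverse_arrows_def hom_def)
  have "monic C n"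
    by (rule iso_monic)
      (use inverse_arrows_sym[OF n] in \<open>auto simp: iso_def\<close>)
  then have "monic C ((f \<cdot> m) \<cdot> n)" by (rule monic_comp)
      (use assms nm in auto)
  also have "(f \<cdot> m) \<cdot> n = f"
    using assms(1,3) nm n by (simp add: comp_assoc inverse_arrows_def)
  finally show ?thesis .
qed

lemma pullback_monic:
  assumes pb: "is_pullback C m u p q" and m: "monic C m"
  shows "monic C q"
  unfolding monic_def
proof (intro conjI allI ballI impI)
  have pq: "m \<in> Arr C" "u \<in> Arr C" "p \<in> Arr C" "q \<in> Arr C" "Dom C p = Dom C q" "Cod C p = Dom C m"
    "Cod C q = Dom C u" "m \<cdot> p = u \<cdot> q" "Cod C m = Cod C u"
    using pb by (auto simp: is_pullback_def hom_def)
  then show "q \<in> Arr C" by simp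
  fix Y a b assume ab: "a \<in> hom C Y (Dom C q)" "b \<in> hom C Y (Dom C q)" "q \<cdot> a = q \<cdot> b"
  have "m \<cdot> (p \<cdot> c) = u \<cdot> (q \<cdot> c)" if "c \<in> hom C Y (Dom C q)" for c
    using that pq by (simp add: hom_def comp_assoc[symmetric])
  then have sq: "m \<cdot> (p \<cdot> a) = u \<cdot> (q \<cdot> a)" "m \<cdot> (p \<cdot> b) = u \<cdot> (q \<cdot> b)" using ab by auto
  \<comment> \<open>Both sides agree after composition with the monic \<open>m\<close>, because
    \<open>m \<cdot> p = u \<cdot> q\<close> and \<open>q \<cdot> a = q \<cdot> b\<close>.
    Uniqueness of the mediating arrow then gives \<open>a = b\<close>.\<close>
  have pa: "p \<cdot> a = p \<cdot> b"
    by (rule monicD[OF m, of _ Y])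
      (use ab pq sq in \<open>auto simp: hom_def\<close>)
  have "p \<cdot> a \<in> hom C Y (Dom C m)" "q \<cdot> a \<in> hom C Y (Dom C u)"
    using ab(1) pq by (auto simp: hom_def)
  then have "\<exists>!h. h \<in> hom C Y (Dom C q) \<and> p \<cdot> h = p \<cdot> a \<and> q \<cdot> h = q \<cdot> a"
    using pb sq(1) unfolding is_pullback_def by blast
  then show "a = b" using ab pa by metis
qed

section \<open>Injective objects and full subcategories\<close>

lemma injective_extend:
  assumes "injective C I" "monic C f" "h \<in> hom C (Dom C f) I"
  obtains k where "k \<in> hom C (Cod C f) I" "k \<cdot> f = h"
proof -
  have "f \<in> hom C (Dom C f) (Cod C f)" using assms(2) by (auto simp: monic_def hom_def)
  then have "h \<in> (\<lambda>h. h \<cdot> f) ` hom C (Cod C f) I"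
    using assms unfolding injective_def by blast
  then show ?thesis using that by auto
qed

lemma injectiveI:
  assumes "I \<in> Obj C"
    and ex: "\<And>f h. monic C f \<Longrightarrow> h \<in> hom C (Dom C f) I \<Longrightarrow> \<exists>k\<in>hom C (Cod C f) I. k \<cdot> f = h"
  shows "injective C I"
  unfolding injective_def
proof (intro conjI allI ballI impI assms(1))
  fix A B f assume f: "f \<in> hom C A B" "monic C f"
  have "(\<lambda>h. h \<cdot> f) ` hom C B I \<subseteq> hom C A I" using f(1) by (auto simp: hom_def)
  moreover have "hom C A I \<subseteq> (\<lambda>h. h \<cdot> f) ` hom C B I"
  proof
    fix h assume "h \<in> hom C A I"
    then obtain k where "k \<in> hom C B I" "h = k \<cdot> f" using ex[OF f(2), of h] f(1) by (auto simp: hom_def)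
    then show "h \<in> (\<lambda>h. h \<cdot> f) ` hom C B I" by (rule rev_image_eqI)
  qed
  ultimately show "(\<lambda>h. h \<cdot> f) ` hom C B I = hom C A I" by blast
qed

text \<open>Extend \<open>i \<cdot> h\<close> along \<open>f\<close> into \<open>I\<close>, then
  return to \<open>A\<close> by \<open>r\<close>.\<close>

lemma injective_retract:
  assumes I: "injective C I" and i: "i \<in> hom C A I" and r: "r \<in> hom C I A"
    and ri: "r \<cdot> i = Ident C A"
  shows "injective C A"
proof (rule injectiveI)
  show "A \<in> Obj C" using i by (auto simp: hom_def)
  fix f h assume f: "monic C f" and h: "h \<in> hom C (Dom C f) A"
  have fA: "f \<in> Arr C" using f by (simp add: monic_def)
  have "i \<cdot> h \<in> hom C (Dom C f) I" using i h by (auto simp: hom_def)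
  then obtain k where k: "k \<in> hom C (Cod C f) I" "k \<cdot> f = i \<cdot> h"
    using injective_extend[OF I f] by blast
  have "(r \<cdot> k) \<cdot> f = (r \<cdot> i) \<cdot> h" using k i r h fA by (simp add: hom_def comp_assoc)
  also have "\<dots> = h" using ri h by (auto simp: hom_def)
  finally show "\<exists>k\<in>hom C (Cod C f) A. k \<cdot> f = h"
    using k(1) r by (intro bexI[of _ "r \<cdot> k"]) (auto simp: hom_def)
qed

lemma full_subcat_category: "category (full_subcat C P)"
  by unfold_locales
    (auto simp: full_subcat_def hom_def comp_assoc)

end

lemma full_subcat_hom: "hom (full_subcat C P) A B = {f \<in> hom C A B. P A \<and> P B}"
  by (auto simp: hom_def full_subcat_def)

lemma full_subcat_sel:
  "Obj (full_subcat C P) = {A \<in> Obj C. P A}"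
  "Ident (full_subcat C P) = Ident C" "Comp (full_subcat C P) = Comp C"
  "Dom (full_subcat C P) = Dom C" "Cod (full_subcat C P) = Cod C"
  by (simp_all add: full_subcat_def)

lemma iso_full_subcat:
  assumes "iso C f" "P (Dom C f)" "P (Cod C f)" shows "iso (full_subcat C P) f"
  using assms unfolding iso_def inverse_arrows_def full_subcat_hom full_subcat_sel
  by (auto simp: full_subcat_def)

locale functor_locale =
  fixes C :: "('o, 'm) cat" and D :: "('p, 'n) cat" and F :: "('o, 'm, 'p, 'n) fnct"
  assumes is_functor: "is_functor C D F"
begin

sublocale C: category C using is_functor by (simp add: is_functor_def)
sublocale D: category D using is_functor by (simp add: is_functor_def)

lemma fob_in [simp]: "A \<in> Obj C \<Longrightarrow> fob F A \<in> Obj D"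
  using is_functor by (simp add: is_functor_def)

lemma far_simps [simp]:
  assumes "f \<in> Arr C"
  shows "far F f \<in> Arr D" "Dom D (far F f) = fob F (Dom C f)" "Cod D (far F f) = fob F (Cod C f)"
  using is_functor homI[OF assms] unfolding is_functor_def by (auto simp: hom_def)

lemma far_ident [simp]: "A \<in> Obj C \<Longrightarrow> far F (Ident C A) = Ident D (fob F A)"
  using is_functor by (simp add: is_functor_def)

lemma far_comp [simp]:
  assumes "f \<in> Arr C" "g \<in> Arr C" "Dom C g = Cod C f"
  shows "far F (g \<cdot>\<^bsub>C\<^esub> f) = far F g \<cdot>\<^bsub>D\<^esub> far F f"
proof -
  have "f \<in> hom C (Dom C f) (Cod C f)" "g \<in> hom C (Cod C f) (Cod C g)"
    using assms by (auto simp: hom_def)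
  then show ?thesis using is_functor unfolding is_functor_def by blast
qed

lemma faithful_reflects_monic:
  assumes "faithful C F" "f \<in> Arr C" "monic D (far F f)" shows "monic C f"
  unfolding monic_def
proof (intro conjI allI ballI impI assms(2))
  fix Y a b assume ab: "a \<in> hom C Y (Dom C f)" "b \<in> hom C Y (Dom C f)" "f \<cdot>\<^bsub>C\<^esub> a = f \<cdot>\<^bsub>C\<^esub> b"
  then have "far F (f \<cdot>\<^bsub>C\<^esub> a) = far F (f \<cdot>\<^bsub>C\<^esub> b)" by simp
  then have "far F f \<cdot>\<^bsub>D\<^esub> far F a = far F f \<cdot>\<^bsub>D\<^esub> far F b"
    using ab(1,2) assms(2) by (auto simp: hom_def)
  then have "far F a = far F b"
    by (rule D.monicD[OF assms(3), of _ "fob F Y", rotated 2])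
      (use ab(1,2) assms(2) in \<open>auto simp: hom_def\<close>)
  moreover have "Y \<in> Obj C" using ab(1) by (auto simp: hom_def)
  then have "inj_on (far F) (hom C Y (Dom C f))" using assms(1,2) by (simp add: faithful_def)
  ultimately show "a = b" using ab(1,2) by (simp add: inj_on_eq_iff)
qed

text \<open>A functor is only a pair of maps, so its restriction to a full subcategory is the same
  \<open>F\<close>.\<close>

lemma restrict: "is_functor (full_subcat C P) D F"
  unfolding is_functor_def full_subcat_sel full_subcat_hom
  using C.full_subcat_category D.category_axioms by (auto simp: hom_def)

lemma corestrict:
  assumes "\<And>A. A \<in> Obj C \<Longrightarrow> P (fob F A)" shows "is_functor C (full_subcat D P) F"
  unfolding is_functor_def full_subcat_sel full_subcat_hom
  using D.full_subcat_category C.category_axioms assms by (auto simp: hom_def)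

end

lemma functor_comp:
  assumes "is_functor C D F" "is_functor D E G" shows "is_functor C E (comp_fnct G F)"
proof -
  interpret F: functor_locale C D F using assms(1) by unfold_locales
  interpret G: functor_locale D E G using assms(2) by unfold_locales
  show ?thesis
    using F.C.category_axioms G.D.category_axioms
    unfolding is_functor_def comp_fnct_def by (auto simp: hom_def)
qed

lemma functor_id: "category C \<Longrightarrow> is_functor C C id_fnct"
  by (simp add: is_functor_def id_fnct_def)

text \<open>\<open>fnct_agree\<close> compares values only on the objects and arrows of the domain,
  so it is weaker than equality of the two records. Functoriality, and below natural isomorphy, must
  therefore be carried along it explicitly.\<close>

lemma functor_agree:
  assumes F: "is_functor C D F" and eq: "fnct_agree C F F'" shows "is_functor C D F'"
proof -
  interpret F: functor_locale C D F using F by unfold_locales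
  have ob: "fob F' A = fob F A" if "A \<in> Obj C" for A using eq that by (simp add: fnct_agree_def)
  have ar: "far F' f = far F f" if "f \<in> Arr C" for f using eq that by (simp add: fnct_agree_def)
  show ?thesis
    using F.C.category_axioms F.D.category_axioms
    unfolding is_functor_def by (auto simp: hom_def ob ar)
qed

lemma nat_iso_agree:
  assumes t: "nat_iso C D F G t" and F: "fnct_agree C F F'" shows "nat_iso C D F' G t"
proof -
  have "is_functor C D F" using t by (simp add: nat_iso_def nat_trans_def)
  then have F': "is_functor C D F'" using F by (rule functor_agree)
  then interpret F: functor_locale C D F' by unfold_locales
  show ?thesis
    using F t F' unfolding nat_iso_def nat_trans_def fnct_agree_def
    by (auto simp: hom_def)
qed

text \<open>Composing the square with the inverses of its two invertible sides turns it around. This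
  serves for inverting natural isomorphisms and for formally reversed arrows in a category of
  fractions.\<close>

lemma inverse_square:
  assumes "category D" and tA: "inverse_arrows D tA sA" and tB: "inverse_arrows D tB sB"
    and u: "u \<in> hom D (Dom D tA) (Dom D tB)" and v: "v \<in> hom D (Cod D tA) (Cod D tB)"
    and sq: "tB \<cdot>\<^bsub>D\<^esub> u = v \<cdot>\<^bsub>D\<^esub> tA"
  shows "sB \<cdot>\<^bsub>D\<^esub> v = u \<cdot>\<^bsub>D\<^esub> sA"
proof -
  interpret category D by fact
  note [simp] = comp_assoc
  have arr: "tA \<in> Arr D" "sA \<in> Arr D" "tB \<in> Arr D" "sB \<in> Arr D" "u \<in> Arr D" "v \<in> Arr D"
    "Dom D sA = Cod D tA" "Cod D sA = Dom D tA" "Dom D sB = Cod D tB" "Cod D sB = Dom D tB"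
    "Dom D u = Dom D tA" "Cod D u = Dom D tB" "Dom D v = Cod D tA" "Cod D v = Cod D tB"
    using tA tB u v by (auto simp: inverse_arrows_def hom_def)
  have "sB \<cdot>\<^bsub>D\<^esub> v = sB \<cdot>\<^bsub>D\<^esub> ((v \<cdot>\<^bsub>D\<^esub> tA) \<cdot>\<^bsub>D\<^esub> sA)"
    using arr tA by (simp add: inverse_arrows_def)
  also have "\<dots> = (sB \<cdot>\<^bsub>D\<^esub> tB) \<cdot>\<^bsub>D\<^esub> (u \<cdot>\<^bsub>D\<^esub> sA)" using arr by (simp add: sq[symmetric])
  also have "\<dots> = u \<cdot>\<^bsub>D\<^esub> sA" using arr tB by (simp add: inverse_arrows_def del: comp_assoc)
  finally show ?thesis .
qed

lemma nat_iso_inverse: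
  assumes t: "nat_iso C D F G t" shows "nat_iso C D G F (\<lambda>A. inv_arrow D (t A))"
proof -
  have fs: "is_functor C D F" "is_functor C D G"
    and tA: "\<And>A. A \<in> Obj C \<Longrightarrow> t A \<in> hom D (fob F A) (fob G A)"
    and sq: "\<And>A B f. f \<in> hom C A B \<Longrightarrow> t B \<cdot>\<^bsub>D\<^esub> far F f = far G f \<cdot>\<^bsub>D\<^esub> t A"
    and i: "\<And>A. A \<in> Obj C \<Longrightarrow> iso D (t A)"
    using t unfolding nat_iso_def nat_trans_def by blast+
  interpret F: functor_locale C D F using fs(1) by unfold_locales
  interpret G: functor_locale C D G using fs(2) by unfold_locales
  note inv = F.D.inverse_arrows_inv[OF i]
  have "inv_arrow D (t A) \<in> hom D (fob G A) (fob F A)" if "A \<in> Obj C" for A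
    using inv[OF that] tA[OF that] by (auto simp: inverse_arrows_def hom_def)
  moreover have "inv_arrow D (t B) \<cdot>\<^bsub>D\<^esub> far G f = far F f \<cdot>\<^bsub>D\<^esub> inv_arrow D (t A)"
    if f: "f \<in> hom C A B" for A B f
  proof -
    have AB: "A \<in> Obj C" "B \<in> Obj C" "f \<in> Arr C" "Dom C f = A" "Cod C f = B"
      using f by (auto simp: hom_def)
    show ?thesis
      by (rule inverse_square[OF F.D.category_axioms inv[OF AB(1)] inv[OF AB(2)] _ _ sq[OF f]])
        (use AB(3-5) tA[OF AB(1)] tA[OF AB(2)] in \<open>auto simp: hom_def\<close>)
  qed
  moreover have "iso D (inv_arrow D (t A))" if "A \<in> Obj C" for A
    using F.D.inverse_arrows_sym[OF inv[OF that]] by (auto simp: iso_def)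
  ultimately show ?thesis using fs unfolding nat_iso_def nat_trans_def by simp
qed


section \<open>Duality\<close>

lemma opcat_sel [simp]:
  "Obj (opcat C) = Obj C" "Arr (opcat C) = Arr C" "Dom (opcat C) = Cod C" "Cod (opcat C) = Dom C"
  "Ident (opcat C) = Ident C" "Comp (opcat C) g f = f \<cdot>\<^bsub>C\<^esub> g"
  by (simp_all add: opcat_def)

lemma hom_opcat [simp]: "hom (opcat C) A B = hom C B A"
  by (auto simp: hom_def)

lemma category_opcat: "category C \<Longrightarrow> category (opcat C)"
proof -
  assume "category C"
  then interpret category C .
  show ?thesis by unfold_locales (auto simp: hom_def comp_assoc)
qed

lemma functor_opcat: "is_functor C D F \<Longrightarrow> is_functor (opcat C) (opcat D) F"
  unfolding is_functor_def by (simp add: category_opcat)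

lemma nat_trans_opcat: "nat_trans C D F G t \<Longrightarrow> nat_trans (opcat C) (opcat D) G F t"
  unfolding nat_trans_def by (auto simp: functor_opcat)

text \<open>Passing to opposites exchanges the two adjoints, and unit with counit; the underlying
  maps stay the same.\<close>

lemma adjunction_opcat:
  "adjunction C X F G \<eta> \<epsilon> \<Longrightarrow> adjunction (opcat X) (opcat C) G F \<epsilon> \<eta>"
  unfolding adjunction_def by (simp add: functor_opcat nat_trans_opcat)

lemma faithful_opcat: "faithful C F \<Longrightarrow> faithful (opcat C) F"
  by (simp add: faithful_def)

lemma inverse_arrows_opcat: "inverse_arrows (opcat C) f g \<longleftrightarrow> inverse_arrows C f g"
  by (auto simp: inverse_arrows_def hom_def)

lemma iso_opcat: "iso (opcat C) f \<longleftrightarrow> iso C f"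
  by (simp add: iso_def inverse_arrows_opcat)

lemma monic_opcat: "monic (opcat C) f \<longleftrightarrow> epic C f"
  by (simp add: monic_def epic_def)

lemma split_monic_opcat: "split_monic (opcat C) f \<longleftrightarrow> split_epic C f"
  by (simp add: split_monic_def split_epic_def monic_opcat)

lemma injectives_opcat: "injectives (opcat C) = opcat (projectives C)"
  by (auto simp: injectives_def projectives_def projective_def full_subcat_def opcat_def)


section \<open>Adjunctions\<close>

locale adjoint_functors =
  fixes C :: "('o, 'm) cat" and X :: "('p, 'n) cat" and F :: "('o, 'm, 'p, 'n) fnct"
    and G :: "('p, 'n, 'o, 'm) fnct" and \<eta> :: "'o \<Rightarrow> 'm" and \<epsilon> :: "'p \<Rightarrow> 'n"
  assumes adjunction: "adjunction C X F G \<eta> \<epsilon>"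
begin

sublocale F: functor_locale C X F using adjunction by unfold_locales (simp add: adjunction_def)
sublocale G: functor_locale X C G using adjunction by unfold_locales (simp add: adjunction_def)

lemma unit_simps [simp]:
  assumes "A \<in> Obj C"
  shows "\<eta> A \<in> Arr C" "Dom C (\<eta> A) = A" "Cod C (\<eta> A) = fob G (fob F A)"
  using adjunction assms
  by (auto simp: adjunction_def nat_trans_def id_fnct_def comp_fnct_def hom_def)

lemma counit_simps [simp]:
  assumes "Y \<in> Obj X"
  shows "\<epsilon> Y \<in> Arr X" "Dom X (\<epsilon> Y) = fob F (fob G Y)" "Cod X (\<epsilon> Y) = Y"
  using adjunction assms
  by (auto simp: adjunction_def nat_trans_def id_fnct_def comp_fnct_def hom_def)

lemma unit_natural:
  assumes "f \<in> hom C A B" shows "\<eta> B \<cdot>\<^bsub>C\<^esub> f = far G (far F f) \<cdot>\<^bsub>C\<^esub> \<eta> A"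
  using adjunction assms
  by (simp add: adjunction_def nat_trans_def id_fnct_def comp_fnct_def)

lemma counit_natural:
  assumes "f \<in> hom X Y Z" shows "\<epsilon> Z \<cdot>\<^bsub>X\<^esub> far F (far G f) = f \<cdot>\<^bsub>X\<^esub> \<epsilon> Y"
  using adjunction assms
  by (simp add: adjunction_def nat_trans_def id_fnct_def comp_fnct_def)

lemma triangles [simp]:
  "A \<in> Obj C \<Longrightarrow> \<epsilon> (fob F A) \<cdot>\<^bsub>X\<^esub> far F (\<eta> A) = Ident X (fob F A)"
  "Y \<in> Obj X \<Longrightarrow> far G (\<epsilon> Y) \<cdot>\<^bsub>C\<^esub> \<eta> (fob G Y) = Ident C (fob G Y)"
  using adjunction by (auto simp: adjunction_def)

text \<open>One half of the bijection between \<open>hom X (fob F A) Y\<close> and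
  \<open>hom C A (fob G Y)\<close>: naturality of \<epsilon> moves \<open>f\<close> outside, and a
  triangle identity removes what remains.\<close>

lemma transpose_left:
  assumes f: "f \<in> hom X (fob F A) Y" and A: "A \<in> Obj C"
  shows "\<epsilon> Y \<cdot>\<^bsub>X\<^esub> far F (far G f \<cdot>\<^bsub>C\<^esub> \<eta> A) = f"
proof -
  have f': "f \<in> Arr X" "Dom X f = fob F A" "Cod X f = Y" "Y \<in> Obj X"
    using f by (auto simp: hom_def)
  have "\<epsilon> Y \<cdot>\<^bsub>X\<^esub> far F (far G f \<cdot>\<^bsub>C\<^esub> \<eta> A) = (\<epsilon> Y \<cdot>\<^bsub>X\<^esub> far F (far G f)) \<cdot>\<^bsub>X\<^esub> far F (\<eta> A)"
    using f' A by (simp add: F.D.comp_assoc)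
  also have "\<dots> = f \<cdot>\<^bsub>X\<^esub> (\<epsilon> (fob F A) \<cdot>\<^bsub>X\<^esub> far F (\<eta> A))"
    unfolding counit_natural[OF f] using f' A by (subst F.D.comp_assoc) auto
  also have "\<dots> = f" using f' A by simp
  finally show ?thesis .
qed

lemma transpose_right:
  assumes g: "g \<in> hom C A (fob G Y)" and Y: "Y \<in> Obj X"
  shows "far G (\<epsilon> Y \<cdot>\<^bsub>X\<^esub> far F g) \<cdot>\<^bsub>C\<^esub> \<eta> A = g"
proof -
  have g': "g \<in> Arr C" "Dom C g = A" "Cod C g = fob G Y" "A \<in> Obj C"
    using g by (auto simp: hom_def)
  have "far G (\<epsilon> Y \<cdot>\<^bsub>X\<^esub> far F g) \<cdot>\<^bsub>C\<^esub> \<eta> A = far G (\<epsilon> Y) \<cdot>\<^bsub>C\<^esub> (far G (far F g) \<cdot>\<^bsub>C\<^esub> \<eta> A)"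
    using g' Y by (simp add: F.C.comp_assoc)
  also have "\<dots> = (far G (\<epsilon> Y) \<cdot>\<^bsub>C\<^esub> \<eta> (fob G Y)) \<cdot>\<^bsub>C\<^esub> g"
    unfolding unit_natural[OF g, symmetric] using g' Y by (subst F.C.comp_assoc) auto
  also have "\<dots> = g" using g' Y by simp
  finally show ?thesis .
qed

lemma transpose_left_inj:
  assumes "f \<in> hom X (fob F A) Y" "g \<in> hom X (fob F A) Y" "A \<in> Obj C"
    "far G f \<cdot>\<^bsub>C\<^esub> \<eta> A = far G g \<cdot>\<^bsub>C\<^esub> \<eta> A"
  shows "f = g"
  using transpose_left[OF assms(1,3)] transpose_left[OF assms(2,3)] assms(4) by metis

lemma transpose_right_inj:
  assumes "f \<in> hom C A (fob G Y)" "g \<in> hom C A (fob G Y)" "Y \<in> Obj X"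
    "\<epsilon> Y \<cdot>\<^bsub>X\<^esub> far F f = \<epsilon> Y \<cdot>\<^bsub>X\<^esub> far F g"
  shows "f = g"
  using transpose_right[OF assms(1,3)] transpose_right[OF assms(2,3)] assms(4) by metis

text \<open>Transposition carries an equation between composites with \<open>far G f\<close> to one
  between composites with \<open>f\<close>, where \<open>f\<close> can be cancelled. The lemma is
  applied to \<open>F\<close> as the right adjoint of \<open>H\<close>.\<close>

lemma right_adjoint_monic:
  assumes f: "monic X f" shows "monic C (far G f)"
  unfolding monic_def
proof (intro conjI allI ballI impI)
  have fA: "f \<in> Arr X" using f by (simp add: monic_def)
  then show "far G f \<in> Arr C" by simp
  fix A a b
  assume ab: "a \<in> hom C A (Dom C (far G f))" "b \<in> hom C A (Dom C (far G f))"
    "far G f \<cdot>\<^bsub>C\<^esub> a = far G f \<cdot>\<^bsub>C\<^esub> b"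
  have ab': "a \<in> hom C A (fob G (Dom X f))" "b \<in> hom C A (fob G (Dom X f))"
    using ab(1,2) fA by auto
  \<comment> \<open>Naturality of transposition in the target object: \<open>f\<close> after the
    transpose of \<open>c\<close> is the transpose of \<open>far G f\<close> after
    \<open>c\<close>.\<close>
  have tr: "f \<cdot>\<^bsub>X\<^esub> (\<epsilon> (Dom X f) \<cdot>\<^bsub>X\<^esub> far F c) = \<epsilon> (Cod X f) \<cdot>\<^bsub>X\<^esub> far F (far G f \<cdot>\<^bsub>C\<^esub> c)"
    if c: "c \<in> hom C A (fob G (Dom X f))" for c
  proof -
    have "f \<cdot>\<^bsub>X\<^esub> (\<epsilon> (Dom X f) \<cdot>\<^bsub>X\<^esub> far F c) = (f \<cdot>\<^bsub>X\<^esub> \<epsilon> (Dom X f)) \<cdot>\<^bsub>X\<^esub> far F c"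
      using c fA by (subst F.D.comp_assoc) (auto simp: hom_def)
    also have "\<dots> = (\<epsilon> (Cod X f) \<cdot>\<^bsub>X\<^esub> far F (far G f)) \<cdot>\<^bsub>X\<^esub> far F c"
      using counit_natural[OF homI[OF fA]] by simp
    also have "\<dots> = \<epsilon> (Cod X f) \<cdot>\<^bsub>X\<^esub> far F (far G f \<cdot>\<^bsub>C\<^esub> c)"
      using c fA by (subst F.D.comp_assoc) (auto simp: hom_def)
    finally show ?thesis .
  qed
  have "\<epsilon> (Dom X f) \<cdot>\<^bsub>X\<^esub> far F a = \<epsilon> (Dom X f) \<cdot>\<^bsub>X\<^esub> far F b"
    by (rule F.D.monicD[OF f, of _ "fob F A"])
      (use tr[OF ab'(1)] tr[OF ab'(2)] ab(3) ab' fA in \<open>auto simp: hom_def\<close>)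
  then show "a = b" 
    by (rule transpose_right_inj[rotated 3]) (use ab' fA in auto)
qed

text \<open>Fullness gives \<open>k\<close> with \<open>far G k = \<eta> (fob G Y)\<close>. One
  triangle identity and faithfulness make \<open>k\<close> a right inverse of
  \<open>\<epsilon> Y\<close>; naturality of \<epsilon> at \<open>k\<close> and the other triangle
  make it a left inverse.\<close>

lemma full_faithful_counit_iso:
  assumes full: "full X C G" and faithful: "faithful X G" and Y: "Y \<in> Obj X"
  shows "iso X (\<epsilon> Y)"
proof -
  have "\<eta> (fob G Y) \<in> hom C (fob G Y) (fob G (fob F (fob G Y)))" using Y by (simp add: hom_def)
  then have "\<eta> (fob G Y) \<in> far G ` hom X Y (fob F (fob G Y))"
    using full Y unfolding full_def by (meson F.fob_in G.fob_in subsetD)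
  then obtain k where k: "k \<in> hom X Y (fob F (fob G Y))" "far G k = \<eta> (fob G Y)" by auto
  have k': "k \<in> Arr X" "Dom X k = Y" "Cod X k = fob F (fob G Y)" using k by (auto simp: hom_def)
  have "far G (\<epsilon> Y \<cdot>\<^bsub>X\<^esub> k) = far G (Ident X Y)" using k' k(2) Y by simp
  then have "\<epsilon> Y \<cdot>\<^bsub>X\<^esub> k = Ident X Y"
    using faithful Y k' unfolding faithful_def inj_on_def by (auto simp: hom_def)
  moreover have "k \<cdot>\<^bsub>X\<^esub> \<epsilon> Y = Ident X (fob F (fob G Y))"
    using counit_natural[OF k(1)] k(2) Y by simp
  ultimately have "inverse_arrows X (\<epsilon> Y) k" using k Y by (simp add: inverse_arrows_def)
  then show ?thesis by (auto simp: iso_def)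
qed

end


section \<open>Adjoint triples\<close>

text \<open>Full faithfulness of \<open>G\<close> enters as invertibility of the counit. In this
  form its dual is invertibility of \<zeta>, which \<open>unit_iso_left\<close> derives, so the
  locale passes to opposite categories.\<close>

locale adjoint_triple =
  C: category C + X: category X +
  F: functor_locale C X F + G: functor_locale X C G + H: functor_locale X C H +
  right: adjoint_functors C X F G \<eta> \<epsilon> + left: adjoint_functors X C H F \<zeta> \<theta>
  for C :: "('o, 'm) cat" and X :: "('p, 'n) cat" and F G H \<eta> \<epsilon> \<zeta> \<theta> +
  assumes counit_iso: "\<And>Y. Y \<in> Obj X \<Longrightarrow> iso X (\<epsilon> Y)"
begin

text \<open>Under the bijections \<open>hom (F H Y) Z \<cong> hom (H Y) (G Z) \<cong> hom Y (F G Z) \<cong> hom Y Z\<close>,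
  composition with \<open>\<zeta> Y\<close> corresponds to the identity of \<open>hom Y Z\<close>.\<close>

lemma unit_epic_left:
  assumes a: "a \<in> hom X (fob F (fob H Y)) Z" and b: "b \<in> hom X (fob F (fob H Y)) Z"
    and Y: "Y \<in> Obj X" and eq: "a \<cdot>\<^bsub>X\<^esub> \<zeta> Y = b \<cdot>\<^bsub>X\<^esub> \<zeta> Y"
  shows "a = b"
proof -
  define tr where "tr c = far G c \<cdot>\<^bsub>C\<^esub> \<eta> (fob H Y)" for c
  have Z: "Z \<in> Obj X" using a by (auto simp: hom_def)
  have tr_hom: "tr c \<in> hom C (fob H Y) (fob G Z)" if "c \<in> hom X (fob F (fob H Y)) Z" for c
    using that Y by (auto simp: hom_def tr_def)
  have \<epsilon>_tr: "\<epsilon> Z \<cdot>\<^bsub>X\<^esub> (far F (tr c) \<cdot>\<^bsub>X\<^esub> \<zeta> Y) = c \<cdot>\<^bsub>X\<^esub> \<zeta> Y"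
    if "c \<in> hom X (fob F (fob H Y)) Z" for c
    using tr_hom[OF that] right.transpose_left[OF that] Y Z
    by (simp add: tr_def[symmetric] hom_def X.comp_assoc[symmetric])
  \<comment> \<open>The isomorphism \<open>\<epsilon> Z\<close> is cancelled here; transposing back,
    first along \<open>H\<close> and \<open>F\<close>, then along \<open>F\<close> and
    \<open>G\<close>, recovers \<open>a = b\<close>.\<close>
  have "far F (tr a) \<cdot>\<^bsub>X\<^esub> \<zeta> Y = far F (tr b) \<cdot>\<^bsub>X\<^esub> \<zeta> Y"
    by (rule X.monicD[OF X.iso_monic[OF counit_iso[OF Z]], of _ Y])
      (use \<epsilon>_tr[OF a] \<epsilon>_tr[OF b] eq tr_hom[OF a] tr_hom[OF b] Y Z in \<open>auto simp: hom_def\<close>)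
  then have "tr a = tr b"
    by (rule left.transpose_left_inj[OF tr_hom[OF a] tr_hom[OF b] Y])
  then show ?thesis
    using right.transpose_left_inj[OF a b] Y by (simp add: tr_def)
qed

lemma unit_iso_left:
  assumes Y: "Y \<in> Obj X" shows "iso X (\<zeta> Y)"
proof -
  obtain k where k: "inverse_arrows X (\<epsilon> Y) k" using counit_iso[OF Y] by (auto simp: iso_def)
  then have k': "k \<in> Arr X" "Dom X k = Y" "Cod X k = fob F (fob G Y)"
    and \<epsilon>k: "\<epsilon> Y \<cdot>\<^bsub>X\<^esub> k = Ident X Y"
    using Y by (auto simp: inverse_arrows_def hom_def)
  \<comment> \<open>The bijections are run backwards from the identity of \<open>Y\<close>: it
    corresponds to \<open>k\<close>, then to the transpose \<open>v\<close> of \<open>k\<close>,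
    then to the transpose \<open>w\<close> of \<open>v\<close>. So \<open>w\<close> is a left
    inverse of \<open>\<zeta> Y\<close>.\<close>
  define v where "v = \<theta> (fob G Y) \<cdot>\<^bsub>C\<^esub> far H k"
  define w where "w = \<epsilon> Y \<cdot>\<^bsub>X\<^esub> far F v"
  have v: "v \<in> Arr C" "Dom C v = fob H Y" "Cod C v = fob G Y"
    using k' Y by (auto simp: v_def)
  then have w: "w \<in> Arr X" "Dom X w = fob F (fob H Y)" "Cod X w = Y"
    using Y by (auto simp: w_def)
  have "far F v \<cdot>\<^bsub>X\<^esub> \<zeta> Y = k"
    unfolding v_def by (rule left.transpose_right)
      (use k' Y in \<open>auto simp: hom_def\<close>)
  then have wz: "w \<cdot>\<^bsub>X\<^esub> \<zeta> Y = Ident X Y"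
    using \<epsilon>k v Y by (simp add: w_def X.comp_assoc)
  \<comment> \<open>Cancelling \<open>\<zeta> Y\<close> on the right, by
    \<open>unit_epic_left\<close>, makes the left inverse two-sided.\<close>
  then have "(\<zeta> Y \<cdot>\<^bsub>X\<^esub> w) \<cdot>\<^bsub>X\<^esub> \<zeta> Y = Ident X (fob F (fob H Y)) \<cdot>\<^bsub>X\<^esub> \<zeta> Y"
    using w Y by (simp add: X.comp_assoc)
  then have "\<zeta> Y \<cdot>\<^bsub>X\<^esub> w = Ident X (fob F (fob H Y))"
    by (rule unit_epic_left[rotated 3]) (use w Y in \<open>auto simp: hom_def\<close>)
  with wz have "inverse_arrows X (\<zeta> Y) w" using w Y by (simp add: inverse_arrows_def hom_def)
  then show ?thesis by (auto simp: iso_def)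
qed

text \<open>By a triangle identity, \<open>far F (\<eta> A)\<close> is a section of the invertible
  \<open>\<epsilon> (fob F A)\<close>.\<close>

lemma F_unit_iso:
  assumes A: "A \<in> Obj C" shows "iso X (far F (\<eta> A))"
proof -
  obtain k where k: "inverse_arrows X (\<epsilon> (fob F A)) k"
    using counit_iso[of "fob F A"] A by (auto simp: iso_def)
  have "inverse_arrows X (\<epsilon> (fob F A)) (far F (\<eta> A))"
    by (rule X.monic_section_iso[OF X.iso_monic[OF counit_iso]])
      (use A in \<open>auto simp: hom_def\<close>)
  then show ?thesis using X.inverse_arrows_sym by (auto simp: iso_def)
qed

lemma F_monic: "monic C f \<Longrightarrow> monic X (far F f)"
  by (rule left.right_adjoint_monic)

text \<open>\<open>F\<close> preserves pullbacks because it has the left adjoint \<open>H\<close>; here only the cone over \<open>m\<close> and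
  \<open>u\<close> with vertex \<open>H (F (Dom u))\<close> is needed, whose mediating arrow yields a section of \<open>F q\<close>.\<close>

lemma F_iso_pullback:
  assumes pb: "is_pullback C m u p q" and m: "monic C m" and Fm: "iso X (far F m)"
  shows "iso X (far F q)"
proof -
  let ?B = "Dom C u"
  have pq: "m \<in> Arr C" "u \<in> Arr C" "p \<in> Arr C" "q \<in> Arr C" "Dom C p = Dom C q"
    "Cod C p = Dom C m" "Cod C q = ?B" "m \<cdot>\<^bsub>C\<^esub> p = u \<cdot>\<^bsub>C\<^esub> q" "Cod C m = Cod C u"
    using pb by (auto simp: is_pullback_def hom_def)
  obtain n where n: "inverse_arrows X (far F m) n" using Fm by (auto simp: iso_def)
  then have n': "n \<in> Arr X" "Dom X n = fob F (Cod C u)" "Cod X n = fob F (Dom C m)"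
    "far F m \<cdot>\<^bsub>X\<^esub> n = Ident X (fob F (Cod C u))"
    using pq by (auto simp: inverse_arrows_def hom_def)
  \<comment> \<open>\<open>b\<close> is the transpose, along \<open>H\<close> and \<open>F\<close>,
    of the lift \<open>n \<cdot> far F u\<close> of \<open>far F u\<close> through
    \<open>far F m\<close>.\<close>
  define b where "b = \<theta> (Dom C m) \<cdot>\<^bsub>C\<^esub> far H (n \<cdot>\<^bsub>X\<^esub> far F u)"
  have b: "b \<in> hom C (fob H (fob F ?B)) (Dom C m)" using pq n' by (simp add: b_def hom_def)
  have mb: "m \<cdot>\<^bsub>C\<^esub> b = u \<cdot>\<^bsub>C\<^esub> \<theta> ?B"
  proof -
    have "m \<cdot>\<^bsub>C\<^esub> b = (m \<cdot>\<^bsub>C\<^esub> \<theta> (Dom C m)) \<cdot>\<^bsub>C\<^esub> far H (n \<cdot>\<^bsub>X\<^esub> far F u)"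
      unfolding b_def using pq n' by (subst C.comp_assoc) auto
    also have "\<dots> = (\<theta> (Cod C m) \<cdot>\<^bsub>C\<^esub> far H (far F m)) \<cdot>\<^bsub>C\<^esub> far H (n \<cdot>\<^bsub>X\<^esub> far F u)"
      using left.counit_natural[OF homI[OF pq(1)]] by simp
    also have "\<dots> = \<theta> (Cod C m) \<cdot>\<^bsub>C\<^esub> far H (far F m \<cdot>\<^bsub>X\<^esub> (n \<cdot>\<^bsub>X\<^esub> far F u))"
      using pq n' by (subst C.comp_assoc) auto
    also have "far F m \<cdot>\<^bsub>X\<^esub> (n \<cdot>\<^bsub>X\<^esub> far F u) = (far F m \<cdot>\<^bsub>X\<^esub> n) \<cdot>\<^bsub>X\<^esub> far F u"
      using pq n' by (subst X.comp_assoc) auto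
    also have "\<dots> = far F u" using n' pq by simp
    also have "\<theta> (Cod C m) \<cdot>\<^bsub>C\<^esub> far H (far F u) = u \<cdot>\<^bsub>C\<^esub> \<theta> ?B"
      using left.counit_natural[OF homI[OF pq(2)]] pq by simp
    finally show ?thesis .
  qed
  have "\<theta> ?B \<in> hom C (fob H (fob F ?B)) ?B" using pq by (simp add: hom_def)
  with pb b mb obtain h where h: "h \<in> hom C (fob H (fob F ?B)) (Dom C q)" "q \<cdot>\<^bsub>C\<^esub> h = \<theta> ?B"
    unfolding is_pullback_def by blast
  have h': "h \<in> Arr C" "Dom C h = fob H (fob F ?B)" "Cod C h = Dom C q"
    using h by (auto simp: hom_def)
  let ?s = "far F h \<cdot>\<^bsub>X\<^esub> \<zeta> (fob F ?B)"
  \<comment> \<open>Since \<open>q \<cdot> h = \<theta> ?B\<close>, a triangle identity shows that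
    \<open>?s\<close> is a section of \<open>far F q\<close>, which is monic because
    \<open>m\<close> and hence \<open>q\<close> is.\<close>
  have "far F q \<cdot>\<^bsub>X\<^esub> ?s = (far F q \<cdot>\<^bsub>X\<^esub> far F h) \<cdot>\<^bsub>X\<^esub> \<zeta> (fob F ?B)"
    using pq h' by (simp add: X.comp_assoc)
  also have "far F q \<cdot>\<^bsub>X\<^esub> far F h = far F (q \<cdot>\<^bsub>C\<^esub> h)"
    by (rule F.far_comp[symmetric]) (use pq h' in auto)
  also have "\<dots> \<cdot>\<^bsub>X\<^esub> \<zeta> (fob F ?B) = Ident X (Cod X (far F q))" using pq h by simp
  finally have "inverse_arrows X (far F q) ?s"
    by (rule X.monic_section_iso[rotated 2, of "far F q"])
      (use F_monic[OF C.pullback_monic[OF pb m]] pq h' in \<open>auto simp: hom_def\<close>)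
  then show ?thesis by (auto simp: iso_def)
qed

end

lemma adjoint_triple_opcat:
  assumes "adjoint_triple C X F G H \<eta> \<epsilon> \<zeta> \<theta>"
  shows "adjoint_triple (opcat C) (opcat X) F H G \<theta> \<zeta> \<epsilon> \<eta>"
proof -
  interpret adjoint_triple C X F G H \<eta> \<epsilon> \<zeta> \<theta> by fact
  interpret op_right: adjoint_functors "opcat C" "opcat X" F H \<theta> \<zeta>
    by unfold_locales (rule adjunction_opcat[OF left.adjunction])
  interpret op_left: adjoint_functors "opcat X" "opcat C" G F \<epsilon> \<eta>
    by unfold_locales (rule adjunction_opcat[OF right.adjunction])
  show ?thesis by unfold_locales (simp add: iso_opcat unit_iso_left)
qed


section \<open>Natural transformations on a category of fractions\<close>

text \<open>Squares over arrows of \<open>C\<close> suffice: commuting is stable under composition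
  and inversion, and every path is composed of images of arrows of \<open>C\<close> and inverses of
  such images.\<close>

lemma fractions_nat_trans:
  assumes C: "category C" and L: "is_functor (fractions C S) D L"
    and M: "is_functor (fractions C S) D M"
    and t: "\<And>A. A \<in> Obj C \<Longrightarrow> t A \<in> hom D (fob L A) (fob M A)"
    and sq: "\<And>A B f. f \<in> hom C A B \<Longrightarrow>
      t B \<cdot>\<^bsub>D\<^esub> far L (far (to_fractions C S) f) = far M (far (to_fractions C S) f) \<cdot>\<^bsub>D\<^esub> t A"
  shows "nat_trans (fractions C S) D L M t"
proof -
  let ?Q = "fractions C S"
  interpret C: category C by fact
  interpret L: functor_locale ?Q D L using L by unfold_locales
  interpret M: functor_locale ?Q D M using M by unfold_locales
  have t': "t A \<in> Arr D" "Dom D (t A) = fob L A" "Cod D (t A) = fob M A" if "A \<in> Obj C" for A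
    using t[OF that] by (auto simp: hom_def)
  define nat where "nat x \<longleftrightarrow> t (Cod ?Q x) \<cdot>\<^bsub>D\<^esub> far L x = far M x \<cdot>\<^bsub>D\<^esub> t (Dom ?Q x)" for x
  have ob: "Dom ?Q x \<in> Obj C" "Cod ?Q x \<in> Obj C" if "x \<in> Arr ?Q" for x
    using L.C.dom_cod_in[OF that] by (auto simp: fractions_sel)
  have nat_comp: "nat (y \<cdot>\<^bsub>?Q\<^esub> x)"
    if x: "x \<in> Arr ?Q" "nat x" and y: "y \<in> Arr ?Q" "nat y" and xy: "Dom ?Q y = Cod ?Q x" for x y
  proof -
    note T = t'[OF ob(1)[OF x(1)]] t'[OF ob(2)[OF x(1)]] t'[OF ob(2)[OF y(1)]]
    have "t (Cod ?Q y) \<cdot>\<^bsub>D\<^esub> (far L y \<cdot>\<^bsub>D\<^esub> far L x) = (t (Cod ?Q y) \<cdot>\<^bsub>D\<^esub> far L y) \<cdot>\<^bsub>D\<^esub> far L x"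
      using T x y xy by (subst L.D.comp_assoc) auto
    also have "\<dots> = far M y \<cdot>\<^bsub>D\<^esub> (t (Cod ?Q x) \<cdot>\<^bsub>D\<^esub> far L x)"
      using y(2) T x y(1) xy by (simp add: nat_def L.D.comp_assoc)
    also have "\<dots> = (far M y \<cdot>\<^bsub>D\<^esub> far M x) \<cdot>\<^bsub>D\<^esub> t (Dom ?Q x)"
      using x(2) T x(1) y xy by (simp add: nat_def L.D.comp_assoc)
    finally show ?thesis using x(1) y(1) xy by (simp add: nat_def)
  qed
  have nat_inverse: "nat y" if xy: "inverse_arrows ?Q x y" and x: "nat x" for x y
  proof -
    have arr: "x \<in> Arr ?Q" "y \<in> Arr ?Q" "Dom ?Q y = Cod ?Q x" "Cod ?Q y = Dom ?Q x"
      using xy by (auto simp: inverse_arrows_def hom_def)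
    note T = t'[OF ob(1)[OF arr(1)]] t'[OF ob(2)[OF arr(1)]]
    have "far M y \<cdot>\<^bsub>D\<^esub> t (Cod ?Q x) = t (Dom ?Q x) \<cdot>\<^bsub>D\<^esub> far L y"
      by (rule inverse_square[OF L.D.category_axioms, of "far L x" _ "far M x"])
      (use functor_inverse_arrows[OF L xy] functor_inverse_arrows[OF M xy] x T arr in \<open>auto simp: hom_def nat_def\<close>)
    then show ?thesis using arr by (simp add: nat_def)
  qed
  have nat_Nil: "nat (A, A, path_class C S A A [])" if "A \<in> Obj C" for A
  proof -
    have "nat (Ident ?Q A)" using that t'[OF that] by (simp add: nat_def fractions_sel(1))
    then show ?thesis by (simp add: fractions_sel)
  qed
  have nat_Fwd: "nat (A, B, path_class C S A B [Fwd f])" if f: "f \<in> hom C A B" for f A B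
    using sq[OF f] by (simp add: nat_def to_fractions_far[OF f] fractions_def)
  have nat_Bwd: "nat (B, A, path_class C S B A [Bwd s])" if s: "s \<in> S" "s \<in> hom C A B" for s A B
    using nat_inverse[OF fractions_inverse[OF C s]] nat_Fwd[OF s(2)]
    by (simp add: to_fractions_far[OF s(2)])
  have nat_Cons: "nat (A, B, path_class C S A B (z # p))"
    if z: "path C S A E [z]" "nat (A, E, path_class C S A E [z])"
      and p: "path C S E B p" "nat (E, B, path_class C S E B p)" for A B E z p
  proof -
    have "(A, E, path_class C S A E [z]) \<in> hom ?Q A E" "(E, B, path_class C S E B p) \<in> hom ?Q E B"
      using z(1) p(1) unfolding fractions_hom by blast+
    then have "nat (Comp ?Q (E, B, path_class C S E B p) (A, E, path_class C S A E [z]))"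
      using z(2) p(2) by (intro nat_comp) (auto simp: hom_def)
    then show ?thesis by (simp add: fractions_Comp[OF z(1) p(1)])
  qed
  have nat_path: "nat (A, B, path_class C S A B p)" if "path C S A B p" for A B p
    using that
  proof (induction p arbitrary: A)
    case Nil
    then show ?case using nat_Nil by auto
  next
    case (Cons z p)
    show ?case
    proof (cases z)
      case (Fwd f)
      with Cons.prems have f: "f \<in> hom C A (Cod C f)" and p: "path C S (Cod C f) B p"
        by (auto simp: hom_def)
      show ?thesis
        using nat_Cons[OF Fwd_path[OF C f] nat_Fwd[OF f] p Cons.IH[OF p]] by (simp add: Fwd)
    next
      case (Bwd s)
      with Cons.prems have s: "s \<in> S" "s \<in> hom C (Dom C s) A" and p: "path C S (Dom C s) B p"
        by (auto simp: hom_def)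
      show ?thesis
        using nat_Cons[OF Bwd_path[OF C s] nat_Bwd[OF s] p Cons.IH[OF p]] by (simp add: Bwd)
    qed
  qed
  have "t B \<cdot>\<^bsub>D\<^esub> far L x = far M x \<cdot>\<^bsub>D\<^esub> t A" if "x \<in> hom ?Q A B" for A B x
  proof -
    have "nat x" using that nat_path unfolding fractions_hom by blast
    then show ?thesis using that by (simp add: nat_def hom_def)
  qed
  then show ?thesis using L M t unfolding nat_trans_def by (simp add: fractions_sel(1))
qed


section \<open>Injective envelopes and the spectral category\<close>

text \<open>The setting of part (a), phrased for an adjoint triple so that its instance at the
  opposite categories yields part (b).\<close>

locale split_localization = adjoint_triple +
  assumes faithful: "faithful C F" and split: "\<And>m. monic X m \<Longrightarrow> split_monic X m"
begin

lemma F_reflects_monic: "f \<in> Arr C \<Longrightarrow> monic X (far F f) \<Longrightarrow> monic C f"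
  by (rule F.faithful_reflects_monic[OF faithful])

text \<open>If \<open>f \<cdot> m\<close> is monic, so is its image under \<open>F\<close>;
  cancelling the invertible \<open>far F m\<close> leaves \<open>far F f\<close> monic, and
  \<open>F\<close> reflects this.\<close>

lemma F_iso_essential:
  assumes m: "m \<in> Arr C" "iso X (far F m)" shows "essential_monic C m"
  unfolding essential_monic_def
proof (intro conjI allI ballI impI)
  show "monic C m" using F_reflects_monic X.iso_monic m by blast
  fix B f assume f: "f \<in> hom C (Cod C m) B" and fm: "monic C (f \<cdot>\<^bsub>C\<^esub> m)"
  have f': "f \<in> Arr C" "Dom C f = Cod C m" using f by (auto simp: hom_def)
  have "monic X (far F f \<cdot>\<^bsub>X\<^esub> far F m)" using F_monic[OF fm] f' m by simp
  then have "monic X (far F f)" 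
    by (rule X.iso_comp_cancel_monic[rotated 3]) (use f' m in auto)
  then show "monic C f" by (rule F_reflects_monic[OF f'(1)])
qed

lemma F_iso_stable_essential:
  assumes m: "m \<in> Arr C" "iso X (far F m)" shows "stable_essential_monic C m"
  unfolding stable_essential_monic_def
proof (intro conjI allI impI)
  show ess: "essential_monic C m" by (rule F_iso_essential[OF m])
  fix u p q assume pb: "is_pullback C m u p q"
  have "q \<in> Arr C" using pb by (simp add: is_pullback_def hom_def)
  then show "essential_monic C q"
    using F_iso_essential F_iso_pullback[OF pb _ m(2)] ess by (simp add: essential_monic_def)
qed

text \<open>A retraction \<open>r\<close> of \<open>F m\<close> transposes to an extension of \<open>\<eta> (Dom m)\<close> along \<open>m\<close>; essentiality
  makes that extension, and with it \<open>r\<close>, monic.\<close>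

lemma essential_F_iso:
  assumes m: "essential_monic C m" shows "iso X (far F m)"
proof -
  let ?S = "Dom C m" let ?A = "Cod C m"
  have mm: "monic C m" and mA: "m \<in> Arr C" using m by (auto simp: essential_monic_def monic_def)
  have "split_monic X (far F m)" by (rule split[OF F_monic[OF mm]])
  then obtain r where r: "r \<in> Arr X" "Dom X r = fob F ?A" "Cod X r = fob F ?S"
    "r \<cdot>\<^bsub>X\<^esub> far F m = Ident X (fob F ?S)"
    using mA by (auto simp: split_monic_def hom_def)
  define r' where "r' = far G r \<cdot>\<^bsub>C\<^esub> \<eta> ?A"
  have r': "r' \<in> Arr C" "Dom C r' = ?A" "Cod C r' = fob G (fob F ?S)"
    using r mA by (auto simp: r'_def)
  have "r' \<cdot>\<^bsub>C\<^esub> m = far G r \<cdot>\<^bsub>C\<^esub> (far G (far F m) \<cdot>\<^bsub>C\<^esub> \<eta> ?S)"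
    using r mA by (simp add: r'_def C.comp_assoc right.unit_natural[OF homI])
  also have "\<dots> = far G (r \<cdot>\<^bsub>X\<^esub> far F m) \<cdot>\<^bsub>C\<^esub> \<eta> ?S"
    using r(1-3) mA by (simp add: C.comp_assoc)
  also have "\<dots> = \<eta> ?S" using r mA by simp
  finally have "monic C (r' \<cdot>\<^bsub>C\<^esub> m)"
    using F_reflects_monic[OF _ X.iso_monic[OF F_unit_iso]] mA by simp
  then have "monic C r'"
    using m r' unfolding essential_monic_def by (auto simp: hom_def)
  then have "monic X (far F r')" by (rule F_monic)
  then have "monic X (\<epsilon> (fob F ?S) \<cdot>\<^bsub>X\<^esub> far F r')"
    by (rule X.monic_comp)
      (use X.iso_monic[OF counit_iso] r' mA in auto)
  moreover have "\<epsilon> (fob F ?S) \<cdot>\<^bsub>X\<^esub> far F r' = r"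
    unfolding r'_def by (rule right.transpose_left)
      (use r mA in \<open>auto simp: hom_def\<close>)
  ultimately have "monic X r" by simp
  then have "inverse_arrows X r (far F m)"
    by (rule X.monic_section_iso)
      (use r mA in \<open>auto simp: hom_def\<close>)
  then show ?thesis using X.inverse_arrows_sym by (auto simp: iso_def)
qed

text \<open>Identifies the class inverted in \<open>Spec C\<close> with the arrows that
  \<open>F\<close> inverts. One direction makes \<open>F\<close> factor through
  \<open>Spec C\<close>, the other makes every \<open>\<eta> A\<close> invertible there.\<close>

lemma stable_essential_iff: "stable_essential_monic C m \<longleftrightarrow> m \<in> Arr C \<and> iso X (far F m)"
proof
  assume "stable_essential_monic C m"
  then have m: "essential_monic C m" by (simp add: stable_essential_monic_def)
  then have "m \<in> Arr C" by (simp add: essential_monic_def monic_def)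
  with essential_F_iso[OF m] show "m \<in> Arr C \<and> iso X (far F m)" by simp
qed (simp add: F_iso_stable_essential)

lemma unit_essential: "A \<in> Obj C \<Longrightarrow> essential_monic C (\<eta> A)"
  by (simp add: F_iso_essential F_unit_iso)

lemma G_injective:
  assumes Y: "Y \<in> Obj X" shows "injective C (fob G Y)"
proof (rule C.injectiveI)
  show "fob G Y \<in> Obj C" using Y by simp
  fix f h assume f: "monic C f" and h: "h \<in> hom C (Dom C f) (fob G Y)"
  have fA: "f \<in> Arr C" using f by (simp add: monic_def)
  have h': "h \<in> Arr C" "Dom C h = Dom C f" "Cod C h = fob G Y" using h by (auto simp: hom_def)
  obtain r where r: "r \<in> Arr X" "Dom X r = fob F (Cod C f)" "Cod X r = fob F (Dom C f)"
    "r \<cdot>\<^bsub>X\<^esub> far F f = Ident X (fob F (Dom C f))"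
    using split[OF F_monic[OF f]] fA by (auto simp: split_monic_def hom_def)
  \<comment> \<open>The transpose of \<open>h\<close>, extended along \<open>far F f\<close> by
    means of the retraction \<open>r\<close>; \<open>?k\<close> is the transpose of
    \<open>?g\<close> back to \<open>C\<close>.\<close>
  let ?g = "(\<epsilon> Y \<cdot>\<^bsub>X\<^esub> far F h) \<cdot>\<^bsub>X\<^esub> r"
  let ?k = "far G ?g \<cdot>\<^bsub>C\<^esub> \<eta> (Cod C f)"
  have g: "?g \<in> hom X (fob F (Cod C f)) Y" using Y h' r by (simp add: hom_def)
  have k: "?k \<in> hom C (Cod C f) (fob G Y)" using Y h' r fA by (simp add: hom_def)
  have "?k \<cdot>\<^bsub>C\<^esub> f = h"
  proof (rule right.transpose_right_inj[OF _ h Y])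
    show kf: "?k \<cdot>\<^bsub>C\<^esub> f \<in> hom C (Dom C f) (fob G Y)"
      by (rule C.Comp_hom[OF homI[OF fA] k])
    have "far F (?k \<cdot>\<^bsub>C\<^esub> f) = far F ?k \<cdot>\<^bsub>X\<^esub> far F f"
      by (rule F.far_comp)
      (use k fA in \<open>auto simp: hom_def\<close>)
    then have "\<epsilon> Y \<cdot>\<^bsub>X\<^esub> far F (?k \<cdot>\<^bsub>C\<^esub> f) = (\<epsilon> Y \<cdot>\<^bsub>X\<^esub> far F ?k) \<cdot>\<^bsub>X\<^esub> far F f"
      using k fA Y by (subst X.comp_assoc) (auto simp: hom_def simp del: F.far_comp)
    also have "\<epsilon> Y \<cdot>\<^bsub>X\<^esub> far F ?k = ?g" by (rule right.transpose_left)
      (use g fA in auto)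
    also have "?g \<cdot>\<^bsub>X\<^esub> far F f = \<epsilon> Y \<cdot>\<^bsub>X\<^esub> far F h"
      using r h' fA Y by (simp add: X.comp_assoc)
    finally show "\<epsilon> Y \<cdot>\<^bsub>X\<^esub> far F (?k \<cdot>\<^bsub>C\<^esub> f) = \<epsilon> Y \<cdot>\<^bsub>X\<^esub> far F h" .
  qed
  with k show "\<exists>k\<in>hom C (Cod C f) (fob G Y). k \<cdot>\<^bsub>C\<^esub> f = h" by blast
qed

lemma unit_injective_envelope: "A \<in> Obj C \<Longrightarrow> injective_envelope C A (\<eta> A)"
  by (simp add: injective_envelope_def unit_essential G_injective)

text \<open>For injective \<open>A\<close>, the identity extends along \<open>\<eta> A\<close> to
  some \<open>r\<close>. Essentiality makes \<open>r\<close> monic, and a monic with section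
  \<open>\<eta> A\<close> is invertible. Conversely \<open>A\<close> is a retract of an object in
  the image of \<open>G\<close>.\<close>

lemma injective_iff_unit_iso:
  assumes A: "A \<in> Obj C" shows "injective C A \<longleftrightarrow> iso C (\<eta> A)"
proof
  assume inj: "injective C A"
  have \<eta>: "monic C (\<eta> A)" using unit_essential[OF A] by (simp add: essential_monic_def)
  obtain r where r: "r \<in> hom C (fob G (fob F A)) A" "r \<cdot>\<^bsub>C\<^esub> \<eta> A = Ident C A"
    by (rule C.injective_extend[OF inj \<eta>, of "Ident C A"]) (use A in \<open>auto simp: hom_def\<close>)
  have "monic C (Ident C A)" using A by (auto simp: monic_def hom_def)
  then have "monic C r"
    using unit_essential[OF A] r A unfolding essential_monic_def by simp
  then have "inverse_arrows C r (\<eta> A)"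
    by (rule C.monic_section_iso)
      (use r A in \<open>auto simp: hom_def\<close>)
  then show "iso C (\<eta> A)" using C.inverse_arrows_sym by (auto simp: iso_def)
next
  assume "iso C (\<eta> A)"
  then obtain r where "inverse_arrows C (\<eta> A) r" by (auto simp: iso_def)
  then have "\<eta> A \<in> hom C A (fob G (fob F A))" "r \<in> hom C (fob G (fob F A)) A"
    "r \<cdot>\<^bsub>C\<^esub> \<eta> A = Ident C A"
    using A by (auto simp: inverse_arrows_def hom_def)
  then show "injective C A" by (rule C.injective_retract[OF G_injective[OF F.fob_in[OF A]]])
qed

section \<open>Equivalence of \<open>X\<close> with the injective objects\<close>

lemma counit_nat_iso: "nat_iso X X (comp_fnct F G) id_fnct \<epsilon>"
  using right.adjunction counit_iso by (simp add: nat_iso_def adjunction_def)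

lemma G_corestrict: "is_functor X (injectives C) G"
  unfolding injectives_def by (rule G.corestrict) (rule G_injective)

lemma F_restrict: "is_functor (injectives C) X F"
  unfolding injectives_def by (rule F.restrict)

text \<open>On injective objects \<eta> is invertible. Its inverse is taken because
  \<open>equivalence_functor\<close> asks for isomorphisms from the composites to the
  identities.\<close>

lemma unit_inverse_nat_iso:
  "nat_iso (injectives C) (injectives C) (comp_fnct G F) id_fnct
    (\<lambda>A. inv_arrow (injectives C) (\<eta> A))"
proof (rule nat_iso_inverse)
  have id: "is_functor (injectives C) (injectives C) id_fnct"
    unfolding injectives_def by (intro functor_id C.full_subcat_category)
  have GF: "is_functor (injectives C) (injectives C) (comp_fnct G F)"
    by (rule functor_comp[OF F_restrict G_corestrict])
  have iso: "iso (full_subcat C (injective C)) (\<eta> A)" if "A \<in> Obj C" "injective C A" for A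
    using that injective_iff_unit_iso[OF that(1)] by (intro iso_full_subcat) (simp_all add: G_injective)
  show "nat_iso (injectives C) (injectives C) id_fnct (comp_fnct G F) \<eta>"
    using iso id GF unfolding nat_iso_def nat_trans_def injectives_def full_subcat_hom full_subcat_sel
    by (auto simp: id_fnct_def comp_fnct_def hom_def right.unit_natural G_injective)
qed

lemma G_equivalence: "equivalence_functor X (injectives C) G"
  unfolding equivalence_functor_def
  using G_corestrict F_restrict counit_nat_iso unit_inverse_nat_iso by blast

section \<open>The functor induced on the spectral category\<close>

lemma Spec_induced_exists: "\<exists>K. Spec_induced C X F K"
proof -
  have "iso X (far F s)" if "s \<in> {m. stable_essential_monic C m}" for s
    using that by (simp add: stable_essential_iff)
  from fractions_universal[OF F.is_functor this] show ?thesis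
    unfolding Spec_induced_def Spec_def to_Spec_def by blast
qed

text \<open>An induced functor is determined only up to agreement on \<open>Spec C\<close>, so the
  equivalences are proved for an arbitrary one.\<close>

context
  fixes K assumes K: "Spec_induced C X F K"
begin

lemma to_Spec_functor: "is_functor C (Spec C) (to_Spec C)"
  unfolding Spec_def to_Spec_def by (rule to_fractions_functor[OF C.category_axioms])

lemma K_functor: "is_functor (Spec C) X K"
  using K by (simp add: Spec_induced_def)

lemma K_to_Spec: "fnct_agree C F (comp_fnct K (to_Spec C))"
  using K by (simp add: Spec_induced_def fnct_agree_def)

text \<open>On images of arrows of \<open>C\<close> the naturality squares are the images of those
  of \<eta>, and \<open>fractions_nat_trans\<close> extends them to all fractions. The components
  are invertible since each \<open>\<eta> A\<close> is pullback stable essential.\<close>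

lemma Spec_unit_nat_iso:
  "nat_iso (Spec C) (Spec C) id_fnct (comp_fnct (to_Spec C) (comp_fnct G K))
    (\<lambda>A. far (to_Spec C) (\<eta> A))"
proof -
  let ?S = "{m. stable_essential_monic C m}"
  let ?M = "comp_fnct (to_Spec C) (comp_fnct G K)"
  interpret Q: functor_locale C "Spec C" "to_Spec C" by unfold_locales (rule to_Spec_functor)
  have M: "is_functor (Spec C) (Spec C) ?M"
    by (intro functor_comp[OF functor_comp[OF K_functor G.is_functor]] to_Spec_functor)
  have Kob: "fob K A = fob F A" if "A \<in> Obj C" for A
    using K_to_Spec that
    by (simp add: fnct_agree_def comp_fnct_def to_Spec_def to_fractions_def)
  have Kar: "far K (far (to_Spec C) f) = far F f" if "f \<in> Arr C" for f
    using K_to_Spec that by (simp add: fnct_agree_def comp_fnct_def)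
  have Qob: "fob (to_Spec C) A = A" for A by (simp add: to_Spec_def to_fractions_def)
  have "nat_trans (fractions C ?S) (Spec C) id_fnct ?M (\<lambda>A. far (to_Spec C) (\<eta> A))"
  proof (rule fractions_nat_trans[OF C.category_axioms])
    show "is_functor (fractions C ?S) (Spec C) id_fnct"
      using functor_id[OF Q.D.category_axioms] by (simp add: Spec_def)
    show "is_functor (fractions C ?S) (Spec C) ?M" using M by (simp add: Spec_def)
  next
    fix A assume "A \<in> Obj C"
    then show "far (to_Spec C) (\<eta> A) \<in> hom (Spec C) (fob id_fnct A) (fob ?M A)"
      by (simp add: hom_def id_fnct_def comp_fnct_def Qob Kob)
  next
    fix A B f assume f: "f \<in> hom C A B"
    then have f': "f \<in> Arr C" "Dom C f = A" "Cod C f = B" "A \<in> Obj C" "B \<in> Obj C"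
      by (auto simp: hom_def)
    have "far (to_Spec C) (\<eta> B) \<cdot>\<^bsub>Spec C\<^esub> far (to_Spec C) f = far (to_Spec C) (\<eta> B \<cdot>\<^bsub>C\<^esub> f)"
      by (rule Q.far_comp[symmetric])
      (use f' in auto)
    also have "\<dots> = far (to_Spec C) (far G (far F f)) \<cdot>\<^bsub>Spec C\<^esub> far (to_Spec C) (\<eta> A)"
      unfolding right.unit_natural[OF f] using f' by simp
    finally show "far (to_Spec C) (\<eta> B) \<cdot>\<^bsub>Spec C\<^esub> far id_fnct (far (to_fractions C ?S) f) =
        far ?M (far (to_fractions C ?S) f) \<cdot>\<^bsub>Spec C\<^esub> far (to_Spec C) (\<eta> A)"
      unfolding to_Spec_def[symmetric] by (simp add: id_fnct_def comp_fnct_def Kar f')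
  qed
  moreover have "iso (Spec C) (far (to_Spec C) (\<eta> A))" if "A \<in> Obj C" for A
    unfolding Spec_def to_Spec_def
    using that by (intro to_fractions_inverts[OF C.category_axioms])
      (auto simp: stable_essential_iff F_unit_iso)
  moreover have "Obj (Spec C) = Obj C" by (simp add: Spec_def fractions_sel)
  ultimately show ?thesis unfolding nat_iso_def by (simp add: Spec_def)
qed

text \<open>The quasi-inverse is \<open>G\<close> followed by \<open>to_Spec C\<close>. The
  composite on \<open>X\<close> agrees with \<open>comp_fnct F G\<close>, so \<epsilon> serves
  there.\<close>

lemma Spec_equivalence: "equivalence_functor (Spec C) X K"
proof -
  have "comp_fnct (to_Spec C) (comp_fnct G K) = comp_fnct (comp_fnct (to_Spec C) G) K"
    by (simp add: comp_fnct_def)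
  note 1 = nat_iso_inverse[OF Spec_unit_nat_iso, unfolded this]
  have "fnct_agree X (comp_fnct F G) (comp_fnct K (comp_fnct (to_Spec C) G))"
    using K_to_Spec by (simp add: fnct_agree_def comp_fnct_def)
  note 2 = nat_iso_agree[OF counit_nat_iso this]
  show ?thesis
    unfolding equivalence_functor_def
    using K_functor functor_comp[OF G.is_functor to_Spec_functor] 1 2 by blast
qed

text \<open>The quasi-inverse is \<open>to_Spec C\<close> restricted to the injective objects. The
  composite on those objects agrees with \<open>comp_fnct G F\<close>, and the one on
  \<open>Spec C\<close> is treated by \<open>Spec_unit_nat_iso\<close>.\<close>

lemma Spec_injectives_equivalence:
  "equivalence_functor (Spec C) (injectives C) (comp_fnct G K)"
proof -
  have "fnct_agree (injectives C) (comp_fnct G F) (comp_fnct (comp_fnct G K) (to_Spec C))"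
    using K_to_Spec
    by (simp add: fnct_agree_def comp_fnct_def injectives_def full_subcat_def)
  note 1 = nat_iso_agree[OF unit_inverse_nat_iso this]
  have "is_functor (injectives C) (Spec C) (to_Spec C)"
    unfolding injectives_def
    using to_Spec_functor by (intro functor_locale.restrict functor_locale.intro)
  then show ?thesis
    unfolding equivalence_functor_def
    using functor_comp[OF K_functor G_corestrict] nat_iso_inverse[OF Spec_unit_nat_iso] 1 by blast
qed

end

theorem injective_envelopes_and_Spec:
  "(\<forall>A\<in>Obj C. injective_envelope C A (\<eta> A) \<and> (injective C A \<longleftrightarrow> iso C (\<eta> A))) \<and>
   equivalence_functor X (injectives C) G \<and>
   (\<forall>m. stable_essential_monic C m \<longrightarrow> iso X (far F m)) \<and>
   (\<exists>K. Spec_induced C X F K) \<and>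
   (\<forall>K. Spec_induced C X F K \<longrightarrow>
      equivalence_functor (Spec C) X K \<and>
      equivalence_functor (Spec C) (injectives C) (comp_fnct G K))"
  using unit_injective_envelope injective_iff_unit_iso G_equivalence stable_essential_iff
    Spec_induced_exists Spec_equivalence Spec_injectives_equivalence by blast

end

section \<open>Faithful essential localizations over a base with split monomorphisms or split
  epimorphisms\<close>

theorem theorem7p1:
  fixes C :: "('o, 'm) cat" and X :: "('p, 'n) cat"
    and F :: "('o, 'm, 'p, 'n) fnct" and G H :: "('p, 'n, 'o, 'm) fnct"
    and \<eta> \<theta> :: "'o \<Rightarrow> 'm" and \<epsilon> \<zeta> :: "'p \<Rightarrow> 'n"
  assumes "category C" and "has_finite_limits C" and "has_finite_colimits C"
    and "category X" and "has_finite_limits X" and "has_finite_colimits X"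
    and localization: "localization C X F G \<eta> \<epsilon>"
    and faithful: "faithful C F"
    and essential: "adjunction X C H F \<zeta> \<theta>"
  shows
    "((\<forall>m. monic X m \<longrightarrow> split_monic X m) \<longrightarrow>
        (\<forall>A\<in>Obj C. injective_envelope C A (\<eta> A) \<and> (injective C A \<longleftrightarrow> iso C (\<eta> A))) \<and>
        equivalence_functor X (injectives C) G \<and>
        (\<forall>m. stable_essential_monic C m \<longrightarrow> iso X (far F m)) \<and>
        (\<exists>K. Spec_induced C X F K) \<and>
        (\<forall>K. Spec_induced C X F K \<longrightarrow>
           equivalence_functor (Spec C) X K \<and>
           equivalence_functor (Spec C) (injectives C) (comp_fnct G K))) \<and>
     ((\<forall>e. epic X e \<longrightarrow> split_epic X e) \<longrightarrow>
        (\<forall>A\<in>Obj C. projective_cover C A (\<theta> A) \<and> (projective C A \<longleftrightarrow> iso C (\<theta> A))) \<and>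
        equivalence_functor (opcat X) (opcat (projectives C)) H \<and>
        (\<forall>m. stable_essential_monic (opcat C) m \<longrightarrow> iso (opcat X) (far F m)) \<and>
        (\<exists>K. Spec_induced (opcat C) (opcat X) F K) \<and>
        (\<forall>K. Spec_induced (opcat C) (opcat X) F K \<longrightarrow>
           equivalence_functor (Spec (opcat C)) (opcat X) K \<and>
           equivalence_functor (Spec (opcat C)) (opcat (projectives C)) (comp_fnct H K)))"
proof -
  have right: "adjunction C X F G \<eta> \<epsilon>" and G: "full X C G" "faithful X G"
    using localization by (auto simp: localization_def)
  interpret right: adjoint_functors C X F G \<eta> \<epsilon> using right by unfold_locales
  interpret left: adjoint_functors X C H F \<zeta> \<theta> using essential by unfold_locales
  have triple: "adjoint_triple C X F G H \<eta> \<epsilon> \<zeta> \<theta>"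
    using right.full_faithful_counit_iso[OF G] by unfold_locales auto
  note op_triple = adjoint_triple_opcat[OF triple]
  show ?thesis
  \<comment> \<open>The instantiation splits only the outer conjunction of the two implications,
    leaving each conclusion whole.\<close>
  proof (intro conjI[of "_ \<longrightarrow> _" "_ \<longrightarrow> _"] impI)
    assume "\<forall>m. monic X m \<longrightarrow> split_monic X m"
    then interpret split_localization C X F G H \<eta> \<epsilon> \<zeta> \<theta>
      using triple faithful by (intro split_localization.intro split_localization_axioms.intro) auto
    show "(\<forall>A\<in>Obj C. injective_envelope C A (\<eta> A) \<and> (injective C A \<longleftrightarrow> iso C (\<eta> A))) \<and>
        equivalence_functor X (injectives C) G \<and>
        (\<forall>m. stable_essential_monic C m \<longrightarrow> iso X (far F m)) \<and>
        (\<exists>K. Spec_induced C X F K) \<and>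
        (\<forall>K. Spec_induced C X F K \<longrightarrow>
           equivalence_functor (Spec C) X K \<and>
           equivalence_functor (Spec C) (injectives C) (comp_fnct G K))"
      by (rule injective_envelopes_and_Spec)
  next
    assume "\<forall>e. epic X e \<longrightarrow> split_epic X e"
    \<comment> \<open>Splitting of epimorphisms in \<open>X\<close> is splitting of monomorphisms in
      \<open>opcat X\<close>; \<open>H\<close> and \<theta> now stand where \<open>G\<close> and
      \<eta> stood.\<close>
    then interpret op: split_localization "opcat C" "opcat X" F H G \<theta> \<zeta> \<epsilon> \<eta>
      using op_triple faithful_opcat[OF faithful]
      by (intro split_localization.intro split_localization_axioms.intro)
        (auto simp: monic_opcat split_monic_opcat)
    show "(\<forall>A\<in>Obj C. projective_cover C A (\<theta> A) \<and> (projective C A \<longleftrightarrow> iso C (\<theta> A))) \<and>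
        equivalence_functor (opcat X) (opcat (projectives C)) H \<and>
        (\<forall>m. stable_essential_monic (opcat C) m \<longrightarrow> iso (opcat X) (far F m)) \<and>
        (\<exists>K. Spec_induced (opcat C) (opcat X) F K) \<and>
        (\<forall>K. Spec_induced (opcat C) (opcat X) F K \<longrightarrow>
           equivalence_functor (Spec (opcat C)) (opcat X) K \<and>
           equivalence_functor (Spec (opcat C)) (opcat (projectives C)) (comp_fnct H K))"
      using op.injective_envelopes_and_Spec
      unfolding injectives_opcat projective_cover_def projective_def iso_opcat[of C]
        opcat_sel(1) .
  qed
qed

end
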